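(* Let $n\ge3$. Each of the vectors $u_\varepsilon$, where $\varepsilon=\mathrm{des},\mathrm{maj},\mathrm{inv}$, generates in $\mathbb C[\mathfrak S_n]$ the same principal left ideal $\mathcal I=\mathbb C[\mathfrak S_n]u_\varepsilon=\mathcal H\oplus\{\mathrm{const}\}$, where $\{\mathrm{const}\}=\mathbb C\cdot\sum_{\sigma\in\mathfrak S_n}\sigma$. The restriction of the left regular representation $\mathrm{Reg}_l$ to $\mathcal I$ is isomorphic to the sum of three irreducible representations $\pi_{(n)}\oplus\pi_{(n-1,1)}\oplus\pi_{(n-2,1^2)}$.
   Context: $\mathfrak S_n$ is the symmetric group on $\{1,\dots,n\}$, with products taken left to right: $(\sigma\tau)(i)=\tau(\sigma(i))$. $\pi_\lambda$ is the irreducible complex representation of $\mathfrak S_n$ corresponding to the Young diagram $\lambda$. For $\sigma\in\mathfrak S_n$: $\mathrm{Des}(\sigma)=\{i\in\{1,\dots,n-1\}:\sigma(i)>\sigma(i+1)\}$, $\mathrm{des}(\sigma)=\#\mathrm{Des}(\sigma)$, $\mathrm{maj}(\sigma)=\sum_{i\in\mathrm{Des}(\sigma)}i$, $\mathrm{inv}(\sigma)=\#\{i<j:\sigma(i)>\sigma(j)\}$. For $\varepsilon=\mathrm{des},\mathrm{maj},\mathrm{inv}$, $u_\varepsilon=\sum_{g\in\mathfrak S_n}\varepsilon(g)g\in\mathbb C[\mathfrak S_n]$. For $1\le i<j\le n$ let $e_{ij}=\frac1{\sqrt{n!}}\sum_{\sigma\in\mathfrak S_n}\varepsilon_{ij}(\sigma)\sigma$,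 where $\varepsilon_{ij}(\sigma)=1$ if $\sigma(i)<\sigma(j)$ and $-1$ if $\sigma(i)>\sigma(j)$; $\mathcal H$ is the linear span of the $e_{ij}$ in $\mathbb C[\mathfrak S_n]$. $\mathrm{Reg}_l$ is the left regular representation of $\mathfrak S_n$ in $\mathbb C[\mathfrak S_n]$ (left multiplication). *)

theory Defs
  imports
    Complex_Main
    "HOL-Algebra.Group"
    "HOL-Combinatorics.Permutations"
    "HOL-Library.Function_Algebras"
    "HOL-Library.Product_Plus"
begin

section \<open>Complex representations of a group\<close>

text \<open>
  A representation lives on a linear subspace \<open>rspace\<close> of an ambient complex vector space, whose
  addition is that of the type and whose scalar multiplication is \<open>rscale\<close>. Only the values of
  \<open>ract g\<close> on \<open>rspace\<close>, for \<open>g\<close> in the group, are relevant.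
\<close>

record ('g, 'v) crep =
  rspace :: "'v set"
  rscale :: "complex \<Rightarrow> 'v \<Rightarrow> 'v"
  ract :: "'g \<Rightarrow> 'v \<Rightarrow> 'v"

locale group_rep = group G + vector_space "rscale R"
  for G :: "('g, 'b) monoid_scheme" (structure)
    and R :: "('g, 'v::ab_group_add) crep" +
  assumes subspace_rspace: "subspace (rspace R)"
    and ract_closed: "g \<in> carrier G \<Longrightarrow> v \<in> rspace R \<Longrightarrow> ract R g v \<in> rspace R"
    and ract_add: "g \<in> carrier G \<Longrightarrow> v \<in> rspace R \<Longrightarrow> w \<in> rspace R \<Longrightarrow>
      ract R g (v + w) = ract R g v + ract R g w"
    and ract_scale: "g \<in> carrier G \<Longrightarrow> v \<in> rspace R \<Longrightarrow>
      ract R g (rscale R c v) = rscale R c (ract R g v)"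
    and ract_one: "v \<in> rspace R \<Longrightarrow> ract R \<one> v = v"
    and ract_mult: "g \<in> carrier G \<Longrightarrow> h \<in> carrier G \<Longrightarrow> v \<in> rspace R \<Longrightarrow>
      ract R (g \<otimes> h) v = ract R g (ract R h v)"

definition irreducible_rep :: "('g, 'b) monoid_scheme \<Rightarrow> ('g, 'v::ab_group_add) crep \<Rightarrow> bool" where
  "irreducible_rep G R \<longleftrightarrow>
     group_rep G R \<and> rspace R \<noteq> {0} \<and>
     (\<forall>W. module.subspace (rscale R) W \<and> W \<subseteq> rspace R \<and>
          (\<forall>g\<in>carrier G. \<forall>w\<in>W. ract R g w \<in> W) \<longrightarrow>
          W = {0} \<or> W = rspace R)"

definition rep_iso ::
  "('g, 'b) monoid_scheme \<Rightarrow> ('g, 'v::ab_group_add) crep \<Rightarrow> ('g, 'w::ab_group_add) crep \<Rightarrow> bool" where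
  "rep_iso G R S \<longleftrightarrow>
     group_rep G R \<and> group_rep G S \<and>
     (\<exists>T. bij_betw T (rspace R) (rspace S) \<and>
          (\<forall>v\<in>rspace R. \<forall>w\<in>rspace R. T (v + w) = T v + T w) \<and>
          (\<forall>c. \<forall>v\<in>rspace R. T (rscale R c v) = rscale S c (T v)) \<and>
          (\<forall>g\<in>carrier G. \<forall>v\<in>rspace R. T (ract R g v) = ract S g (T v)))"

definition rep_sum ::
  "('g, 'v::ab_group_add) crep \<Rightarrow> ('g, 'w::ab_group_add) crep \<Rightarrow> ('g, 'v \<times> 'w) crep" where
  "rep_sum R S =
     \<lparr>rspace = rspace R \<times> rspace S,
      rscale = (\<lambda>c (v, w). (rscale R c v, rscale S c w)),
      ract = (\<lambda>g (v, w). (ract R g v, ract S g w))\<rparr>"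

definition rep_restrict :: "('g, 'v) crep \<Rightarrow> 'v set \<Rightarrow> ('g, 'v) crep" where
  "rep_restrict R W = R\<lparr>rspace := W\<rparr>"


section \<open>The complex group algebra of a finite group\<close>

text \<open>
  Elements \<open>\<Sum>g. f(g) g\<close> of the group algebra are identified with their coefficient functions
  \<open>f\<close>, which vanish outside the carrier. Vector addition is the pointwise one.
\<close>

definition cscale :: "complex \<Rightarrow> ('g \<Rightarrow> complex) \<Rightarrow> 'g \<Rightarrow> complex" (infixr "*\<^sub>C" 75) where
  "c *\<^sub>C f = (\<lambda>x. c * f x)"

global_interpretation cfun: vector_space "cscale :: complex \<Rightarrow> ('g \<Rightarrow> complex) \<Rightarrow> 'g \<Rightarrow> complex"
  by unfold_locales (auto simp: cscale_def fun_eq_iff algebra_simps)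

definition gbasis :: "'g \<Rightarrow> 'g \<Rightarrow> complex" where
  "gbasis g = (\<lambda>x. if x = g then 1 else 0)"

definition group_algebra :: "('g, 'b) monoid_scheme \<Rightarrow> ('g \<Rightarrow> complex) set" where
  "group_algebra G = {f. \<forall>x. x \<notin> carrier G \<longrightarrow> f x = 0}"

definition ga_mult ::
  "('g, 'b) monoid_scheme \<Rightarrow> ('g \<Rightarrow> complex) \<Rightarrow> ('g \<Rightarrow> complex) \<Rightarrow> 'g \<Rightarrow> complex" where
  "ga_mult G f h =
     (\<lambda>x. \<Sum>y\<in>carrier G. \<Sum>z\<in>carrier G. if y \<otimes>\<^bsub>G\<^esub> z = x then f y * h z else 0)"

definition principal_left_ideal ::
  "('g, 'b) monoid_scheme \<Rightarrow> ('g \<Rightarrow> complex) \<Rightarrow> ('g \<Rightarrow> complex) set" where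
  "principal_left_ideal G u = {ga_mult G f u |f. f \<in> group_algebra G}"

definition left_regular :: "('g, 'b) monoid_scheme \<Rightarrow> ('g, 'g \<Rightarrow> complex) crep" where
  "left_regular G =
     \<lparr>rspace = group_algebra G, rscale = cscale, ract = (\<lambda>g f. ga_mult G (gbasis g) f)\<rparr>"

definition internal_direct_sum :: "'v::ab_group_add set \<Rightarrow> 'v set \<Rightarrow> 'v set \<Rightarrow> bool" where
  "internal_direct_sum V A B \<longleftrightarrow> V = {a + b |a b. a \<in> A \<and> b \<in> B} \<and> A \<inter> B = {0}"


section \<open>The symmetric group and its irreducible representations\<close>

text \<open>
  Products are taken left to right: \<open>(\<sigma> \<otimes> \<tau>) i = \<tau> (\<sigma> i)\<close>. Permutations of \<open>{1..n}\<close> are extended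
  by the identity to all natural numbers.
\<close>

definition Sym :: "nat \<Rightarrow> (nat \<Rightarrow> nat) monoid" where
  "Sym n = \<lparr>carrier = {\<sigma>. \<sigma> permutes {1..n}}, monoid.mult = (\<lambda>\<sigma> \<tau>. \<tau> \<circ> \<sigma>), one = id\<rparr>"

text \<open>
  \<open>cell \<mu> k\<close> is the cell (row, column) containing \<open>k\<close> in the standard tableau of shape \<open>\<mu>\<close> obtained
  by writing \<open>1, 2, \<dots>\<close> along the rows, from the first row on. Rows are numbered from 0,
  columns from 1; the value for the empty shape is irrelevant.
\<close>

fun cell :: "nat list \<Rightarrow> nat \<Rightarrow> nat \<times> nat" where
  "cell [] k = (0, k)"
| "cell (l # ls) k = (if k \<le> l then (0, k) else (case cell ls (k - l) of (r, c) \<Rightarrow> (Suc r, c)))"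

definition row_group :: "nat \<Rightarrow> nat list \<Rightarrow> (nat \<Rightarrow> nat) set" where
  "row_group n \<mu> = {p. p permutes {1..n} \<and> (\<forall>k\<in>{1..n}. fst (cell \<mu> (p k)) = fst (cell \<mu> k))}"

definition column_group :: "nat \<Rightarrow> nat list \<Rightarrow> (nat \<Rightarrow> nat) set" where
  "column_group n \<mu> = {p. p permutes {1..n} \<and> (\<forall>k\<in>{1..n}. snd (cell \<mu> (p k)) = snd (cell \<mu> k))}"

definition row_symmetrizer :: "nat \<Rightarrow> nat list \<Rightarrow> (nat \<Rightarrow> nat) \<Rightarrow> complex" where
  "row_symmetrizer n \<mu> = (\<Sum>p\<in>row_group n \<mu>. gbasis p)"

definition column_antisymmetrizer :: "nat \<Rightarrow> nat list \<Rightarrow> (nat \<Rightarrow> nat) \<Rightarrow> complex" where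
  "column_antisymmetrizer n \<mu> = (\<Sum>p\<in>column_group n \<mu>. of_int (sign p) *\<^sub>C gbasis p)"

definition young_symmetrizer :: "nat \<Rightarrow> nat list \<Rightarrow> (nat \<Rightarrow> nat) \<Rightarrow> complex" where
  "young_symmetrizer n \<mu> = ga_mult (Sym n) (column_antisymmetrizer n \<mu>) (row_symmetrizer n \<mu>)"

text \<open>
  The representation \<open>\<pi>\<^sub>\<mu>\<close> for a partition \<open>\<mu>\<close> of \<open>n\<close>, as the left ideal generated by the Young
  symmetrizer (the Specht module). Its isomorphism class depends neither on the order of the two
  factors of the Young symmetrizer nor on the choice of left-to-right products; the trivial
  representation corresponds to \<open>[n]\<close>.
\<close>

definition specht_rep :: "nat \<Rightarrow> nat list \<Rightarrow> (nat \<Rightarrow> nat, (nat \<Rightarrow> nat) \<Rightarrow> complex) crep" where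
  "specht_rep n \<mu> =
     rep_restrict (left_regular (Sym n)) (principal_left_ideal (Sym n) (young_symmetrizer n \<mu>))"


section \<open>Permutation statistics\<close>

definition Des :: "nat \<Rightarrow> (nat \<Rightarrow> nat) \<Rightarrow> nat set" where
  "Des n \<sigma> = {i \<in> {1..n - 1}. \<sigma> i > \<sigma> (i + 1)}"

definition des :: "nat \<Rightarrow> (nat \<Rightarrow> nat) \<Rightarrow> nat" where
  "des n \<sigma> = card (Des n \<sigma>)"

definition maj :: "nat \<Rightarrow> (nat \<Rightarrow> nat) \<Rightarrow> nat" where
  "maj n \<sigma> = \<Sum> (Des n \<sigma>)"

definition inversions :: "nat \<Rightarrow> (nat \<Rightarrow> nat) \<Rightarrow> nat" where
  "inversions n \<sigma> = card {(i, j). 1 \<le> i \<and> i < j \<and> j \<le> n \<and> \<sigma> i > \<sigma> j}"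

definition stat_vec :: "nat \<Rightarrow> ((nat \<Rightarrow> nat) \<Rightarrow> nat) \<Rightarrow> (nat \<Rightarrow> nat) \<Rightarrow> complex" where
  "stat_vec n \<epsilon> = (\<Sum>g\<in>carrier (Sym n). of_nat (\<epsilon> g) *\<^sub>C gbasis g)"

definition e_vec :: "nat \<Rightarrow> nat \<Rightarrow> nat \<Rightarrow> (nat \<Rightarrow> nat) \<Rightarrow> complex" where
  "e_vec n i j =
     complex_of_real (1 / sqrt (fact n)) *\<^sub>C
       (\<Sum>\<sigma>\<in>carrier (Sym n). (if \<sigma> i < \<sigma> j then 1 else - 1) *\<^sub>C gbasis \<sigma>)"

definition H_space :: "nat \<Rightarrow> ((nat \<Rightarrow> nat) \<Rightarrow> complex) set" where
  "H_space n = cfun.span {e_vec n i j |i j. 1 \<le> i \<and> i < j \<and> j \<le> n}"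

definition const_space :: "nat \<Rightarrow> ((nat \<Rightarrow> nat) \<Rightarrow> complex) set" where
  "const_space n = cfun.span {\<Sum>\<sigma>\<in>carrier (Sym n). gbasis \<sigma>}"

end

(*
  Left translation acts on the e_ij by permuting indices, so H is a quotient of the space of
  alternating n x n matrices under simultaneous permutation of rows and columns; exchanging two
  adjacent values of a permutation shows that the e_ij (i < j) and the constants are linearly
  independent, hence I = H + const is parametrised by pairs (constant, alternating matrix).

  Alternating matrices split into gradients c_i - c_j and matrices with vanishing row sums, by
  n b = (r_i - r_j) + rest with r the row sums of b.  Both pieces are irreducible by elementary
  arguments: a difference with a transposition produces an elementary gradient, antisymmetrising
  over three indices produces a 3-cycle.  They are identified with the Specht modules of (n-1,1)
  and (n-2,1,1), whose Young symmetrizers are, as functions of a permutation s, combinations of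
  the indicators of s(i) = n, respectively of s(i) = n-1 and s(j) = n.

  des, maj and inv are weighted inversion numbers, sum of w_ij over i < j with s(i) > s(j).
  Averaging over the group isolates the constant, and the two remaining components are non-zero
  because w_12 > 0 gives a non-zero row sum and w_12 + w_23 - w_13 is a non-zero cyclic sum.
*)
theory Submission
  imports Defs
begin

text \<open>With left-to-right products, left translation by g evaluates a function at
  \<open>x \<circ> inv g\<close>: it moves positions and leaves values alone. That is why pairs of
  positions index everything and why the action on matrices is the relabelling \<open>pull\<close>.
  The delicate point is that a vector with non-zero components in both pieces of the alternating
  matrices might generate only a diagonal copy. One explicit element settles this: antisymmetrising
  b over i, j, k gives 2 (b(i,j) + b(j,k) + b(k,i)) times a 3-cycle. It kills gradients, whose
  cyclic sums vanish, and so reaches the second piece directly; subtracting that piece from n b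
  leaves the gradient of the row sums. The ideal and the direct sum of Specht modules are both
  parametrised by the same pairs (constant, alternating matrix), compatibly with the action, so that
  the isomorphism comes from comparing two bijections.\<close>

lemma sum_fun_apply: "(\<Sum>i\<in>A. f i) x = (\<Sum>i\<in>A. f i x)"
  by (induction A rule: infinite_finite_induct) auto

section \<open>Representations\<close>

lemma (in group) ga_mult_gbasis:
  assumes "finite (carrier G)" "g \<in> carrier G"
  shows "ga_mult G (gbasis g) f = (\<lambda>x. if x \<in> carrier G then f (inv g \<otimes> x) else 0)"
proof
  fix x
  have "ga_mult G (gbasis g) f x = (\<Sum>y\<in>carrier G. if y = g then \<Sum>z\<in>carrier G. if y \<otimes> z = x then f
      z else 0 else 0)"
    unfolding ga_mult_def gbasis_def by (auto intro!: sum.neutral sum.cong cong: if_cong)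
  also have "\<dots> = (\<Sum>z\<in>carrier G. if g \<otimes> z = x then f z else 0)"
    using assms by simp
  also have "\<dots> = (if x \<in> carrier G then f (inv g \<otimes> x) else 0)"
  proof (cases "x \<in> carrier G")
    case True
    have "(\<Sum>z\<in>carrier G. if g \<otimes> z = x then f z else 0)
        = (\<Sum>z\<in>carrier G. if z = inv g \<otimes> x then f z else 0)"
      using assms True by (intro sum.cong) (auto simp: inv_solve_left)
    then show ?thesis using assms True by simp
  next
    case False
    then show ?thesis using assms by (auto intro!: sum.neutral)
  qed
  finally show "ga_mult G (gbasis g) f x = (if x \<in> carrier G then f (inv g \<otimes> x) else 0)" .
qed

text \<open>Reduces multiplication to translations, so that left ideals can be treated as
  translation-invariant subspaces.\<close>

lemma ga_mult_eq_sum: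
  assumes "finite (carrier G)"
  shows "ga_mult G f h = (\<Sum>g\<in>carrier G. f g *\<^sub>C ga_mult G (gbasis g) h)"
proof
  fix x
  have *: "ga_mult G (gbasis g) h x = (\<Sum>z\<in>carrier G. if g \<otimes>\<^bsub>G\<^esub> z = x then h z else 0)"
    if "g \<in> carrier G" for g
  proof -
    have "ga_mult G (gbasis g) h x = (\<Sum>y\<in>carrier G. if y = g then \<Sum>z\<in>carrier G. if y \<otimes>\<^bsub>G\<^esub> z = x
        then h z else 0 else 0)"
      unfolding ga_mult_def gbasis_def by (auto intro!: sum.neutral sum.cong cong: if_cong)
    then show ?thesis using that assms by simp
  qed
  show "ga_mult G f h x = (\<Sum>g\<in>carrier G. f g *\<^sub>C ga_mult G (gbasis g) h) x"
    unfolding sum_fun_apply ga_mult_def[of G f] cscale_def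
    by (intro sum.cong) (auto simp: * sum_distrib_left intro!: sum.cong)
qed

lemma ga_mult_in: "group G \<Longrightarrow> ga_mult G f h \<in> group_algebra G"
  unfolding group_algebra_def ga_mult_def
  by (auto intro!: sum.neutral simp: group.is_monoid monoid.m_closed)

lemma subspace_group_algebra: "cfun.subspace (group_algebra G)"
  by (auto simp: cfun.subspace_def group_algebra_def cscale_def)

section \<open>Left ideals as translation-invariant subspaces\<close>

definition left_invariant :: "('g, 'b) monoid_scheme \<Rightarrow> ('g \<Rightarrow> complex) set \<Rightarrow> bool" where
  "left_invariant G W \<longleftrightarrow> (\<forall>g\<in>carrier G. \<forall>w\<in>W. ga_mult G (gbasis g) w \<in> W)"

context group
begin

lemma gbasis_mult:
  assumes "finite (carrier G)" "g \<in> carrier G" "h \<in> carrier G"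
  shows "ga_mult G (gbasis (g \<otimes> h)) f = ga_mult G (gbasis g) (ga_mult G (gbasis h) f)"
  using assms by (auto simp: ga_mult_gbasis fun_eq_iff inv_mult_group m_assoc)

lemma gbasis_mult_one:
  assumes "finite (carrier G)" "f \<in> group_algebra G"
  shows "ga_mult G (gbasis \<one>) f = f"
  using assms by (auto simp: ga_mult_gbasis fun_eq_iff group_algebra_def)

lemma gbasis_mult_add:
  assumes "finite (carrier G)" "g \<in> carrier G"
  shows "ga_mult G (gbasis g) (v + w) = ga_mult G (gbasis g) v + ga_mult G (gbasis g) w"
  using assms by (auto simp: ga_mult_gbasis fun_eq_iff)

lemma gbasis_mult_scale:
  assumes "finite (carrier G)" "g \<in> carrier G"
  shows "ga_mult G (gbasis g) (c *\<^sub>C v) = c *\<^sub>C ga_mult G (gbasis g) v"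
  using assms by (auto simp: ga_mult_gbasis fun_eq_iff cscale_def)

lemma group_rep_restrict:
  assumes "finite (carrier G)" "cfun.subspace W" "left_invariant G W" "W \<subseteq> group_algebra G"
  shows "group_rep G (rep_restrict (left_regular G) W)"
proof -
  interpret vector_space "rscale (rep_restrict (left_regular G) W)"
    unfolding rep_restrict_def left_regular_def by (simp add: cfun.vector_space_axioms)
  show ?thesis
  proof
    show "subspace (rspace (rep_restrict (left_regular G) W))"
      using assms(2) by (simp add: rep_restrict_def left_regular_def)
  qed (use assms in \<open>auto simp: rep_restrict_def left_regular_def left_invariant_def gbasis_mult
         gbasis_mult_one gbasis_mult_add gbasis_mult_scale\<close>)
qed

lemma principal_left_ideal_least:
  assumes "finite (carrier G)" "cfun.subspace W" "left_invariant G W" "u \<in> W"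
  shows "principal_left_ideal G u \<subseteq> W"
  using assms unfolding principal_left_ideal_def left_invariant_def
  by (auto simp: ga_mult_eq_sum[of G _ u] intro!: cfun.subspace_sum cfun.subspace_scale)

lemma subspace_principal_left_ideal:
  assumes "finite (carrier G)"
  shows "cfun.subspace (principal_left_ideal G u)"
proof (rule cfun.subspaceI)
  have "ga_mult G 0 u = 0" by (simp add: ga_mult_def fun_eq_iff cong: if_cong)
  then show "0 \<in> principal_left_ideal G u"
    using subspace_group_algebra cfun.subspace_0 unfolding principal_left_ideal_def by fastforce
next
  fix x y assume "x \<in> principal_left_ideal G u" "y \<in> principal_left_ideal G u"
  then obtain f h where fh: "f \<in> group_algebra G" "h \<in> group_algebra G"
    "x = ga_mult G f u" "y = ga_mult G h u" unfolding principal_left_ideal_def by auto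
  then have "x + y = ga_mult G (f + h) u"
    using assms by (simp add: ga_mult_eq_sum[of G f u] ga_mult_eq_sum[of G h u] ga_mult_eq_sum[of
        G "f + h" u] sum.distrib cfun.scale_left_distrib)
  then show "x + y \<in> principal_left_ideal G u"
    using fh cfun.subspace_add[OF subspace_group_algebra] unfolding principal_left_ideal_def by
        blast
next
  fix c x assume "x \<in> principal_left_ideal G u"
  then obtain f where f: "f \<in> group_algebra G" "x = ga_mult G f u"
    unfolding principal_left_ideal_def by auto
  then have "c *\<^sub>C x = ga_mult G (c *\<^sub>C f) u"
    using assms by (simp add: ga_mult_eq_sum[of G f u] ga_mult_eq_sum[of G "c *\<^sub>C f" u]
        cfun.scale_sum_right fun_cong[OF cscale_def[of c f]])
  then show "c *\<^sub>C x \<in> principal_left_ideal G u"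
    using f cfun.subspace_scale[OF subspace_group_algebra] unfolding principal_left_ideal_def by
        blast
qed

lemma gbasis_mult_sum:
  assumes "finite (carrier G)" "g \<in> carrier G"
  shows "ga_mult G (gbasis g) (\<Sum>i\<in>A. v i) = (\<Sum>i\<in>A. ga_mult G (gbasis g) (v i))"
  using assms by (auto simp: ga_mult_gbasis fun_eq_iff sum_fun_apply)

lemma gbasis_in: "g \<in> carrier G \<Longrightarrow> gbasis g \<in> group_algebra G"
  by (auto simp: group_algebra_def gbasis_def)

lemma gbasis_mult_in_ideal:
  assumes "g \<in> carrier G"
  shows "ga_mult G (gbasis g) u \<in> principal_left_ideal G u"
  using assms gbasis_in unfolding principal_left_ideal_def by blast

lemma left_invariant_principal_left_ideal:
  assumes "finite (carrier G)"
  shows "left_invariant G (principal_left_ideal G u)"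
  unfolding left_invariant_def
proof safe
  fix g w assume g: "g \<in> carrier G" and "w \<in> principal_left_ideal G u"
  then obtain f where w: "w = ga_mult G f u" unfolding principal_left_ideal_def by auto
  have "ga_mult G (gbasis g) w = (\<Sum>h\<in>carrier G. f h *\<^sub>C ga_mult G (gbasis (g \<otimes> h)) u)"
    using assms g by (simp add: w ga_mult_eq_sum[of G f u] gbasis_mult_sum gbasis_mult_scale
        gbasis_mult)
  also have "\<dots> \<in> principal_left_ideal G u"
    using g subspace_principal_left_ideal[OF assms]
    by (intro cfun.subspace_sum cfun.subspace_scale gbasis_mult_in_ideal) auto
  finally show "ga_mult G (gbasis g) w \<in> principal_left_ideal G u" .
qed

lemma generator_in_principal_left_ideal:
  assumes "finite (carrier G)" "u \<in> group_algebra G"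
  shows "u \<in> principal_left_ideal G u"
  using gbasis_mult_in_ideal[of \<one> u] assms by (simp add: gbasis_mult_one)

lemma principal_left_ideal_subset: "principal_left_ideal G u \<subseteq> group_algebra G"
  unfolding principal_left_ideal_def using ga_mult_in is_group by auto

end

section \<open>Direct sums and isomorphisms of representations\<close>

lemma group_rep_rep_sum:
  assumes "group_rep G R" "group_rep G S"
  shows "group_rep G (rep_sum R S)"
proof -
  interpret R: group_rep G R by fact
  interpret S: group_rep G S by fact
  interpret vector_space "rscale (rep_sum R S)"
    by unfold_locales
      (auto simp: rep_sum_def R.scale_right_distrib S.scale_right_distrib
         R.scale_left_distrib S.scale_left_distrib)
  show ?thesis
  proof
    show "subspace (rspace (rep_sum R S))"
      using R.subspace_rspace S.subspace_rspace
      unfolding subspace_def R.subspace_def S.subspace_def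
      by (auto simp: rep_sum_def zero_prod_def)
  qed (auto simp: rep_sum_def R.ract_closed S.ract_closed R.ract_add S.ract_add R.ract_scale
       S.ract_scale R.ract_one S.ract_one R.ract_mult S.ract_mult)
qed

text \<open>The isomorphism is \<open>Q \<circ> inv_into M P\<close>. The index set M carries no
  structure of its own: sums, multiples and translates enter through a witness m'' that has to serve
  P and Q simultaneously.\<close>

lemma rep_iso_parametrisation:
  assumes reps: "group_rep G R" "group_rep G S"
    and P: "bij_betw P M (rspace R)" and Q: "bij_betw Q M (rspace S)"
    and add: "\<And>m m'. m \<in> M \<Longrightarrow> m' \<in> M \<Longrightarrow> \<exists>m''\<in>M. P m'' = P m + P m' \<and> Q m'' = Q m + Q m'"
    and scale: "\<And>c m. m \<in> M \<Longrightarrow> \<exists>m''\<in>M. P m'' = rscale R c (P m) \<and> Q m'' = rscale S c (Q m)"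
    and act: "\<And>g m. g \<in> carrier G \<Longrightarrow> m \<in> M \<Longrightarrow>
      \<exists>m''\<in>M. P m'' = ract R g (P m) \<and> Q m'' = ract S g (Q m)"
  shows "rep_iso G R S"
proof -
  define T where "T = Q \<circ> inv_into M P"
  have T: "T (P m) = Q m" if "m \<in> M" for m
    using that P by (simp add: T_def bij_betw_def)
  have bij: "bij_betw T (rspace R) (rspace S)"
    unfolding T_def using bij_betw_trans[OF bij_betw_inv_into[OF P] Q] .
  have R: "rspace R = P ` M" using P by (simp add: bij_betw_def)
  have "T (v + w) = T v + T w" if "v \<in> P ` M" "w \<in> P ` M" for v w
    using that add T by (metis imageE)
  moreover have "T (rscale R c v) = rscale S c (T v)" if "v \<in> P ` M" for c v
    using that scale[of _ c] T by (metis imageE)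
  moreover have "T (ract R g v) = ract S g (T v)" if "g \<in> carrier G" "v \<in> P ` M" for g v
    using that act T by (metis imageE)
  ultimately show ?thesis using reps bij unfolding rep_iso_def R by blast
qed

section \<open>Alternating matrices under simultaneous permutation of rows and columns\<close>

text \<open>Since \<open>pull g (pull h b) = pull (h \<circ> g) b\<close>, this is a left action for
  the left-to-right product, like left translation.\<close>

definition pull :: "(nat \<Rightarrow> nat) \<Rightarrow> (nat \<times> nat \<Rightarrow> complex) \<Rightarrow> nat \<times> nat \<Rightarrow> complex" where
  "pull g b = (\<lambda>(i, j). b (g i, g j))"

definition pull_invariant :: "nat \<Rightarrow> (nat \<times> nat \<Rightarrow> complex) set \<Rightarrow> bool" where
  "pull_invariant n W \<longleftrightarrow> (\<forall>g b. g permutes {1..n} \<longrightarrow> b \<in> W \<longrightarrow> pull g b \<in> W)"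

definition alt :: "nat \<Rightarrow> (nat \<times> nat \<Rightarrow> complex) set" where
  "alt n = {b. (\<forall>i j. b (i, j) = - b (j, i)) \<and> (\<forall>i j. i \<notin> {1..n} \<longrightarrow> b (i, j) = 0)}"

definition rowsum :: "nat \<Rightarrow> (nat \<times> nat \<Rightarrow> complex) \<Rightarrow> nat \<Rightarrow> complex" where
  "rowsum n b i = (\<Sum>j\<in>{1..n}. b (i, j))"

text \<open>Alternating matrices are flows on the complete graph with vertices 1, ..., n; this is
  its cycle space, and \<open>gradient\<close> is the coboundary of a function on the
  vertices.\<close>

definition cyc :: "nat \<Rightarrow> (nat \<times> nat \<Rightarrow> complex) set" where
  "cyc n = {b \<in> alt n. \<forall>i. rowsum n b i = 0}"

definition gradient :: "nat \<Rightarrow> (nat \<Rightarrow> complex) \<Rightarrow> nat \<times> nat \<Rightarrow> complex" where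
  "gradient n c = (\<lambda>(i, j). if i \<in> {1..n} \<and> j \<in> {1..n} then c i - c j else 0)"

definition elt :: "nat \<Rightarrow> nat \<Rightarrow> nat \<times> nat \<Rightarrow> complex" where
  "elt p q = (\<lambda>x. of_bool (x = (p, q)) - of_bool (x = (q, p)))"

definition cycle3 :: "nat \<Rightarrow> nat \<Rightarrow> nat \<Rightarrow> nat \<times> nat \<Rightarrow> complex" where
  "cycle3 p q r = elt p q + elt q r + elt r p"

lemma altD:
  assumes "b \<in> alt n"
  shows "b (i, j) = - b (j, i)" "b (i, i) = 0" "i \<notin> {1..n} \<Longrightarrow> b (i, j) = 0"
    "j \<notin> {1..n} \<Longrightarrow> b (i, j) = 0"
proof -
  show *: "b (i, j) = - b (j, i)" for i j using assms unfolding alt_def by blast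
  show **: "i \<notin> {1..n} \<Longrightarrow> b (i, j) = 0" for i j using assms unfolding alt_def by blast
  show "b (i, i) = 0" using *[of i i] by simp
  show "j \<notin> {1..n} \<Longrightarrow> b (i, j) = 0" using *[of i j] **[of j i] by simp
qed

lemma altI:
  assumes "\<And>i j. b (i, j) = - b (j, i)" "\<And>i j. i \<notin> {1..n} \<Longrightarrow> b (i, j) = 0"
  shows "b \<in> alt n"
  using assms unfolding alt_def by blast

lemma subspace_alt: "cfun.subspace (alt n)"
proof (rule cfun.subspaceI)
  show "0 \<in> alt n" by (simp add: alt_def)
next
  fix a b assume a: "a \<in> alt n" and b: "b \<in> alt n"
  have "(a + b) (i, j) = - (a + b) (j, i)" for i j
    using altD(1)[OF a, of i j] altD(1)[OF b, of i j] by simp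
  moreover have "(a + b) (i, j) = 0" if "i \<notin> {1..n}" for i j
    using altD(3)[OF a that] altD(3)[OF b that] by simp
  ultimately show "a + b \<in> alt n" by (rule altI)
next
  fix c b assume b: "b \<in> alt n"
  have "(c *\<^sub>C b) (i, j) = - (c *\<^sub>C b) (j, i)" for i j
    using altD(1)[OF b, of i j] by (simp add: cscale_def)
  moreover have "(c *\<^sub>C b) (i, j) = 0" if "i \<notin> {1..n}" for i j
    using altD(3)[OF b that] by (simp add: cscale_def)
  ultimately show "c *\<^sub>C b \<in> alt n" by (rule altI)
qed

lemma rowsum_add: "rowsum n (a + b) i = rowsum n a i + rowsum n b i"
  by (simp add: rowsum_def sum.distrib)

lemma rowsum_scale: "rowsum n (c *\<^sub>C b) i = c * rowsum n b i"
  by (simp add: rowsum_def cscale_def sum_distrib_left)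

lemma rowsum_diff: "rowsum n (a - b) i = rowsum n a i - rowsum n b i"
  by (simp add: rowsum_def sum_subtractf)

lemma subspace_cyc: "cfun.subspace (cyc n)"
  using subspace_alt[of n]
  by (auto simp: cfun.subspace_def cyc_def rowsum_add rowsum_scale) (simp add: rowsum_def)

lemma rowsum_pull:
  assumes "g permutes {1..n}"
  shows "rowsum n (pull g b) i = rowsum n b (g i)"
  unfolding rowsum_def pull_def
  using sum.permute[OF assms, of "\<lambda>j. b (g i, j)"] by (simp add: o_def)

lemma pull_invariant_alt: "pull_invariant n (alt n)"
  unfolding pull_invariant_def
proof (intro allI impI)
  fix g b assume g: "g permutes {1..n}" and b: "b \<in> alt n"
  have "pull g b (i, j) = - pull g b (j, i)" for i j
    using altD(1)[OF b, of "g i" "g j"] by (simp add: pull_def)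
  moreover have "pull g b (i, j) = 0" if "i \<notin> {1..n}" for i j
  proof -
    have "g i \<notin> {1..n}" using that permutes_in_image[OF g] by blast
    then show ?thesis using altD(3)[OF b] by (simp add: pull_def)
  qed
  ultimately show "pull g b \<in> alt n" by (rule altI)
qed

lemma pull_invariant_cyc: "pull_invariant n (cyc n)"
  using pull_invariant_alt[of n] unfolding pull_invariant_def cyc_def by (auto simp: rowsum_pull)

lemma pull_gradient:
  assumes "g permutes {1..n}"
  shows "pull g (gradient n c) = gradient n (c \<circ> g)"
  unfolding pull_def gradient_def permutes_in_image[OF assms] by (simp add: fun_eq_iff
      permutes_in_image[OF assms] del: atLeastAtMost_iff One_nat_def)

lemma gradient_in_alt: "gradient n c \<in> alt n"
  by (auto simp: gradient_def alt_def)

lemma sum_rowsum: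
  assumes "b \<in> alt n"
  shows "(\<Sum>i\<in>{1..n}. rowsum n b i) = 0"
proof -
  have "(\<Sum>i\<in>{1..n}. rowsum n b i) = (\<Sum>j\<in>{1..n}. \<Sum>i\<in>{1..n}. b (i, j))"
    unfolding rowsum_def by (rule sum.swap)
  also have "\<dots> = (\<Sum>j\<in>{1..n}. \<Sum>i\<in>{1..n}. - b (j, i))"
    by (intro sum.cong refl altD(1)[OF assms])
  also have "\<dots> = - (\<Sum>i\<in>{1..n}. rowsum n b i)"
    by (simp add: rowsum_def sum_negf)
  finally show ?thesis by simp
qed

lemma rowsum_gradient:
  assumes "i \<in> {1..n}"
  shows "rowsum n (gradient n c) i = of_nat n * c i - (\<Sum>j\<in>{1..n}. c j)"
  using assms by (simp add: rowsum_def gradient_def sum_subtractf)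

text \<open>The row sums r of an alternating matrix total zero, so the gradient of r has row sums n
  r, exactly those of n b. Scaling by n instead of dividing keeps this valid for n = 0.\<close>

lemma alt_decomposition:
  assumes "b \<in> alt n"
  shows "of_nat n *\<^sub>C b - gradient n (rowsum n b) \<in> cyc n"
proof -
  have a: "of_nat n *\<^sub>C b - gradient n (rowsum n b) \<in> alt n"
    by (intro cfun.subspace_diff cfun.subspace_scale subspace_alt gradient_in_alt assms)
  have "rowsum n (of_nat n *\<^sub>C b - gradient n (rowsum n b)) i = 0" for i
  proof (cases "i \<in> {1..n}")
    case True
    then show ?thesis unfolding rowsum_diff rowsum_scale rowsum_gradient[OF True] sum_rowsum[OF
        assms] by simp
  next
    case False
    then show ?thesis unfolding rowsum_def[of n _ i] by (intro sum.neutral ballI altD(3)[OF a])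
  qed
  with a show ?thesis by (simp add: cyc_def)
qed

section \<open>Elementary alternating matrices and 3-cycles\<close>

lemma elt_in_alt: "p \<in> {1..n} \<Longrightarrow> q \<in> {1..n} \<Longrightarrow> elt p q \<in> alt n"
proof (rule altI)
  assume pq: "p \<in> {1..n}" "q \<in> {1..n}"
  show "elt p q (i, j) = - elt p q (j, i)" for i j by (simp add: elt_def conj_commute)
  show "elt p q (i, j) = 0" if "i \<notin> {1..n}" for i j
  proof -
    have "i \<noteq> p" "i \<noteq> q" using that pq by metis+
    then show ?thesis by (simp add: elt_def)
  qed
qed

lemma cycle3_in_alt: "p \<in> {1..n} \<Longrightarrow> q \<in> {1..n} \<Longrightarrow> r \<in> {1..n} \<Longrightarrow> cycle3 p q r \<in> alt n"
  unfolding cycle3_def by (intro cfun.subspace_add subspace_alt elt_in_alt)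

lemma rowsum_elt:
  assumes "p \<in> {1..n}" "q \<in> {1..n}"
  shows "rowsum n (elt p q) i = of_bool (i = p) - of_bool (i = q)"
proof -
  have "rowsum n (elt p q) i = (\<Sum>j\<in>{1..n}. if j = q then of_bool (i = p) else 0)
      - (\<Sum>j\<in>{1..n}. if j = p then of_bool (i = q) else 0)"
    unfolding rowsum_def elt_def sum_subtractf[symmetric] by (intro sum.cong) auto
  then show ?thesis using assms by simp
qed

lemma cycle3_in_cyc: "p \<in> {1..n} \<Longrightarrow> q \<in> {1..n} \<Longrightarrow> r \<in> {1..n} \<Longrightarrow> cycle3 p q r \<in> cyc n"
  using cycle3_in_alt[of p n q r] unfolding cyc_def by (simp add: cycle3_def rowsum_add rowsum_elt)

lemma pull_elt:
  assumes "g permutes S"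
  shows "pull g (elt (g p) (g q)) = elt p q"
  by (rule ext) (simp add: pull_def elt_def inj_eq[OF permutes_inj[OF assms]] split: prod.split)

lemma pull_add: "pull g (a + b) = pull g a + pull g b"
  by (auto simp: pull_def fun_eq_iff)

lemma pull_cycle3:
  assumes "g permutes S"
  shows "pull g (cycle3 (g p) (g q) (g r)) = cycle3 p q r"
  unfolding cycle3_def by (simp add: pull_add pull_elt[OF assms])

text \<open>Three transpositions in turn: each carries the next point to its target and fixes the
  targets already reached, because these differ from the two points it exchanges.\<close>

lemma three_transitive:
  assumes pqr: "{p, q, r} \<subseteq> S" "distinct [p, q, r]" and ijk: "{i, j, k} \<subseteq> S" "distinct [i, j, k]"
  obtains g where "g permutes S" "g p = i" "g q = j" "g r = k"
proof -
  have S: "p \<in> S" "q \<in> S" "r \<in> S" "i \<in> S" "j \<in> S" "k \<in> S" using pqr(1) ijk(1) by auto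
  have d: "p \<noteq> q" "q \<noteq> r" "p \<noteq> r" "i \<noteq> j" "j \<noteq> k" "i \<noteq> k" using pqr(2) ijk(2) by auto
  define t1 where "t1 = transpose p i"
  define t2 where "t2 = transpose (t1 q) j"
  define t3 where "t3 = transpose (t2 (t1 r)) k"
  have t1: "t1 permutes S" unfolding t1_def by (intro permutes_swap_id S)
  have t2: "t2 permutes S"
    unfolding t2_def using S permutes_in_image[OF t1] by (intro permutes_swap_id) simp_all
  have t3: "t3 permutes S"
    unfolding t3_def using S permutes_in_image[OF t1] permutes_in_image[OF t2]
    by (intro permutes_swap_id) simp_all
  note inj = inj_eq[OF permutes_inj[OF t1]] inj_eq[OF permutes_inj[OF t2]]
  have p1: "t1 p = i" by (simp add: t1_def)
  have "t1 q \<noteq> i" using d(1) inj(1)[of q p] p1 by simp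
  then have p2: "t2 (t1 p) = i" using p1 d by (simp add: t2_def transpose_def)
  have q2: "t2 (t1 q) = j" by (simp add: t2_def)
  have "t2 (t1 r) \<noteq> i" "t2 (t1 r) \<noteq> j"
    using d p2 q2 inj(1)[of r p] inj(1)[of r q] inj(2)[of "t1 r" "t1 p"] inj(2)[of "t1 r" "t1 q"]
    by simp_all
  then have "t3 i = i" "t3 j = j" using d by (simp_all add: t3_def transpose_def)
  moreover have "t3 (t2 (t1 r)) = k" by (simp add: t3_def)
  ultimately show thesis
    using that[of "t3 \<circ> (t2 \<circ> t1)"] permutes_compose[OF permutes_compose[OF t1 t2] t3] p2 q2
    by simp
qed

text \<open>Every edge (p, q) is completed to the triangle p, q, m. The edges (p, q) add up to 2 b
  because b is alternating; the edges at m cancel because row and column sums vanish.\<close>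

lemma cyc_eq_sum_cycle3:
  assumes b: "b \<in> cyc n" and m: "m \<in> {1..n}"
  shows "2 *\<^sub>C b = (\<Sum>p\<in>{1..n}. \<Sum>q\<in>{1..n}. b (p, q) *\<^sub>C cycle3 p q m)"
proof
  have alt: "b \<in> alt n" and r: "(\<Sum>j\<in>{1..n}. b (i, j)) = 0" for i
    using b by (auto simp: cyc_def rowsum_def)
  have c: "(\<Sum>j\<in>{1..n}. b (j, i)) = 0" for i
  proof -
    have "(\<Sum>j\<in>{1..n}. b (j, i)) = (\<Sum>j\<in>{1..n}. - b (i, j))"
      by (intro sum.cong refl altD(1)[OF alt])
    then show ?thesis using r[of i] by (simp add: sum_negf)
  qed
  fix x :: "nat \<times> nat" obtain i j where x: "x = (i, j)" by force
  have e1: "(\<Sum>p\<in>{1..n}. \<Sum>q\<in>{1..n}. b (p, q) * elt p q (i, j)) = 2 * b (i, j)"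
  proof -
    have "(\<Sum>p\<in>{1..n}. \<Sum>q\<in>{1..n}. b (p, q) * elt p q (i, j))
      = (\<Sum>p\<in>{1..n}. \<Sum>q\<in>{1..n}. (if q = j then if p = i then b (i, j) else 0 else 0))
      - (\<Sum>p\<in>{1..n}. \<Sum>q\<in>{1..n}. (if q = i then if p = j then b (j, i) else 0 else 0))"
      unfolding sum_subtractf[symmetric] by (intro sum.cong) (auto simp: elt_def)
    also have "\<dots> = b (i, j) - b (j, i)" using altD(3,4)[OF alt] by (auto simp: sum.If_cases)
    finally show ?thesis using altD(1)[OF alt, of j i] by simp
  qed
  have e2: "(\<Sum>p\<in>{1..n}. \<Sum>q\<in>{1..n}. b (p, q) * elt q m (i, j)) = 0"
    by (subst sum.swap) (simp add: sum_distrib_right[symmetric] c del: One_nat_def)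
  have e3: "(\<Sum>p\<in>{1..n}. \<Sum>q\<in>{1..n}. b (p, q) * elt m p (i, j)) = 0"
    by (simp add: sum_distrib_right[symmetric] r del: One_nat_def)
  show "(2 *\<^sub>C b) x = (\<Sum>p\<in>{1..n}. \<Sum>q\<in>{1..n}. b (p, q) *\<^sub>C cycle3 p q m) x"
    using e1 e2 e3 unfolding x
    by (simp add: sum_fun_apply cscale_def cycle3_def distrib_left sum.distrib)
qed

lemma cycle3_degenerate: "\<not> distinct [p, q, r] \<Longrightarrow> cycle3 p q r = 0"
proof -
  have r: "elt p p = 0" for p by (rule ext) (simp add: elt_def)
  have s: "elt p q + elt q p = 0" for p q by (rule ext) (simp add: elt_def)
  assume "\<not> distinct [p, q, r]"
  then consider "p = q" | "q = r" | "p = r" by auto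
  then show ?thesis using s by cases (simp_all add: cycle3_def r)
qed

lemma cyc_subset_if_cycle3:
  assumes W: "cfun.subspace W" "pull_invariant n W"
    and ijk: "{i, j, k} \<subseteq> {1..n}" "distinct [i, j, k]" and z: "cycle3 i j k \<in> W"
  shows "cyc n \<subseteq> W"
proof
  fix b assume b: "b \<in> cyc n"
  have all: "cycle3 p q r \<in> W" if pqr: "{p, q, r} \<subseteq> {1..n}" for p q r
  proof (cases "distinct [p, q, r]")
    case True
    obtain g where g: "g permutes {1..n}" "g p = i" "g q = j" "g r = k"
      using three_transitive[OF pqr True ijk] by metis
    then have "cycle3 p q r = pull g (cycle3 i j k)" using pull_cycle3[OF g(1), of p q r] by simp
    then show ?thesis using W(2) g(1) z by (simp add: pull_invariant_def)
  next
    case False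
    then show ?thesis using W(1) by (simp add: cycle3_degenerate cfun.subspace_0)
  qed
  have "2 *\<^sub>C b \<in> W"
    unfolding cyc_eq_sum_cycle3[OF b, of i, OF ijk(1)[THEN subsetD], simplified]
    using W(1) all ijk by (intro cfun.subspace_sum cfun.subspace_scale) auto
  then have "(1/2) *\<^sub>C (2 *\<^sub>C b) \<in> W" by (rule cfun.subspace_scale[OF W(1)])
  then show "b \<in> W" by simp
qed

text \<open>The antisymmetriser of \<open>{i, j, k}\<close> kills all entries of \<open>b\<close> outside \<open>{i, j, k}\<^sup>2\<close>.\<close>

lemma cyc_subset:
  assumes W: "cfun.subspace W" "pull_invariant n W" and b: "b \<in> W" "b \<in> alt n"
    and ijk: "{i, j, k} \<subseteq> {1..n}" "b (i, j) + b (j, k) + b (k, i) \<noteq> 0"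
  shows "cyc n \<subseteq> W"
proof -
  note b' = altD(1,2)[OF b(2)]
  have "i \<noteq> j" using ijk(2) b'(1)[of i k] b'(2) by auto
  moreover have "j \<noteq> k" using ijk(2) b'(1)[of i k] b'(2) by auto
  moreover have "k \<noteq> i" using ijk(2) b'(1)[of i j] b'(2) by auto
  ultimately have d: "distinct [i, j, k]" by auto
  then have d': "i \<noteq> j" "j \<noteq> k" "i \<noteq> k" "j \<noteq> i" "k \<noteq> j" "k \<noteq> i" by auto
  define s where "s = b (i, j) + b (j, k) + b (k, i)"
  define t where "t = transpose i j"
  define r where "r = transpose i j \<circ> transpose j k"
  have t: "t permutes {1..n}" using ijk unfolding t_def by (intro permutes_swap_id) auto
  have r: "r permutes {1..n}"
    using ijk unfolding r_def by (intro permutes_compose permutes_swap_id) auto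
  define b1 where "b1 = b - pull t b"
  define b2 where "b2 = b1 + pull r b1 + pull r (pull r b1)"
  have inv: "pull g a \<in> W" if "g permutes {1..n}" "a \<in> W" for g a
    using W(2) that by (simp add: pull_invariant_def)
  have b1: "b1 \<in> W" unfolding b1_def by (intro cfun.subspace_diff W inv t b)
  have b2: "b2 \<in> W" unfolding b2_def by (intro cfun.subspace_add W inv r b1)
  have ri: "r i = j" "r j = k" "r k = i" "\<And>l. l \<noteq> i \<Longrightarrow> l \<noteq> j \<Longrightarrow> l \<noteq> k \<Longrightarrow> r l = l"
    using d' by (auto simp: r_def transpose_def)
  have ti: "t i = j" "t j = i" "\<And>l. l \<noteq> i \<Longrightarrow> l \<noteq> j \<Longrightarrow> t l = l"
    by (auto simp: t_def transpose_def)
  \<comment> \<open>Inside the triple, \<open>b1 (i, j)\<close> is 2 b(i,j), while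
    \<open>b1 (j, k)\<close> and \<open>b1 (k, i)\<close> both equal b(j,k) + b(k,i); the total is 2
    s. For an index l outside, \<open>b1 (i, l)\<close> and \<open>b1 (j, l)\<close> are opposite
    and \<open>b1 (k, l)\<close> is 0.\<close>
  have "b2 (p, q) = (2 * s) * cycle3 i j k (p, q)" for p q
  proof -
    have p: "p = i \<or> p = j \<or> p = k \<or> (p \<noteq> i \<and> p \<noteq> j \<and> p \<noteq> k)"
     and q: "q = i \<or> q = j \<or> q = k \<or> (q \<noteq> i \<and> q \<noteq> j \<and> q \<noteq> k)" by auto
    note sw = b'(1)[of j i] b'(1)[of k j] b'(1)[of i k]
    show ?thesis
      using p q d'
      by (elim disjE conjE)
         (simp_all add: b2_def b1_def pull_def ri ti cycle3_def elt_def s_def sw b'(2))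
  qed
  then have "b2 = (2 * s) *\<^sub>C cycle3 i j k" by (auto simp: fun_eq_iff cscale_def)
  then have "(1 / (2 * s)) *\<^sub>C ((2 * s) *\<^sub>C cycle3 i j k) \<in> W"
    using b2 W(1) by (metis cfun.subspace_scale)
  moreover have "s \<noteq> 0" using ijk(2) by (simp add: s_def)
  ultimately have "cycle3 i j k \<in> W" by simp
  then show ?thesis using cyc_subset_if_cycle3[OF W ijk(1) d] by blast
qed

section \<open>Generating all gradients, and all alternating matrices\<close>

lemma gradients_subset:
  assumes W: "cfun.subspace W" "pull_invariant n W" and c: "gradient n c \<in> W"
    and pq: "p \<in> {1..n}" "q \<in> {1..n}" "c p \<noteq> c q"
  shows "range (gradient n) \<subseteq> W"
proof -
  define \<gamma> where "\<gamma> p = gradient n (\<lambda>i. of_bool (i = p))" for p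
  have inv: "pull g a \<in> W" if "g permutes {1..n}" "a \<in> W" for g a
    using W(2) that by (simp add: pull_invariant_def)
  have t: "transpose p q permutes {1..n}" using pq by (intro permutes_swap_id)
  have "gradient n c - pull (transpose p q) (gradient n c) \<in> W"
    by (intro cfun.subspace_diff W inv t c)
  moreover have "gradient n c - pull (transpose p q) (gradient n c) = (c p - c q) *\<^sub>C (\<gamma> p - \<gamma> q)"
    using pq unfolding pull_gradient[OF t]
    by (auto simp: \<gamma>_def gradient_def fun_eq_iff cscale_def transpose_def)
  ultimately have "(1 / (c p - c q)) *\<^sub>C ((c p - c q) *\<^sub>C (\<gamma> p - \<gamma> q)) \<in> W"
    using W(1) by (metis cfun.subspace_scale)
  then have pq': "\<gamma> p - \<gamma> q \<in> W" using pq by simp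
  have pull_\<gamma>: "pull g (\<gamma> (g i)) = \<gamma> i" if "g permutes {1..n}" for g i
    unfolding \<gamma>_def pull_gradient[OF that]
    by (intro arg_cong[of _ _ "gradient n"]) (simp add: inj_eq[OF permutes_inj[OF that]] fun_eq_iff)
  have all: "\<gamma> i - \<gamma> j \<in> W" if ij: "i \<in> {1..n}" "j \<in> {1..n}" for i j
  proof (cases "i = j")
    case True
    then show ?thesis using W(1) by (simp add: cfun.subspace_0)
  next
    case False
    define g1 where "g1 = transpose i p"
    \<comment> \<open>Only two values are prescribed: n = 2 is allowed here, and then there is no
      third point for \<open>three_transitive\<close>.\<close>
    define g where "g = transpose (g1 j) q \<circ> g1"
    have g1: "g1 permutes {1..n}" unfolding g1_def using ij pq by (intro permutes_swap_id)
    then have "g1 j \<in> {1..n}" using ij by (simp only: permutes_in_image)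
    then have g: "g permutes {1..n}"
      unfolding g_def using g1 pq by (intro permutes_compose permutes_swap_id)
    have "g1 j \<noteq> g1 i" using False by (simp add: inj_eq[OF permutes_inj[OF g1]])
    then have "g i = p" "g j = q" using pq by (auto simp: g_def g1_def transpose_def)
    then have "\<gamma> i - \<gamma> j = pull g (\<gamma> p - \<gamma> q)"
      using pull_\<gamma>[OF g, of i] pull_\<gamma>[OF g, of j] by (auto simp: pull_def fun_eq_iff)
    then show ?thesis using inv[OF g pq'] by simp
  qed
  have grad: "gradient n f (i, j) = f i - f j" if "i \<in> {1..n} \<and> j \<in> {1..n}" for f i j
    using that by (simp add: gradient_def)
  have grad0: "gradient n f (i, j) = 0" if "\<not> (i \<in> {1..n} \<and> j \<in> {1..n})" for f i j
    using that by (auto simp: gradient_def)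
  \<comment> \<open>The \<gamma> j add up to the gradient of a constant function. Averaging \<gamma>
    i - \<gamma> j over j therefore isolates \<gamma> i.\<close>
  have sum0: "(\<Sum>j\<in>{1..n}. \<gamma> j) = 0"
  proof
    fix x :: "nat \<times> nat" obtain i j where x: "x = (i, j)" by force
    show "(\<Sum>j\<in>{1..n}. \<gamma> j) x = 0 x"
      unfolding sum_fun_apply x \<gamma>_def
    proof (cases "i \<in> {1..n} \<and> j \<in> {1..n}")
      case True
      then show "(\<Sum>k\<in>{1..n}. gradient n (\<lambda>i. of_bool (i = k)) (i, j)) = 0 (i, j)"
        unfolding grad[OF True] sum_subtractf by simp
    next
      case False
      then show "(\<Sum>k\<in>{1..n}. gradient n (\<lambda>i. of_bool (i = k)) (i, j)) = 0 (i, j)"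
        unfolding grad0[OF False] by simp
    qed
  qed
  have n: "n \<noteq> 0" using pq by auto
  have \<gamma>W: "\<gamma> i \<in> W" if "i \<in> {1..n}" for i
  proof -
    have "(1 / of_nat n) *\<^sub>C (\<Sum>j\<in>{1..n}. \<gamma> i - \<gamma> j) \<in> W"
      using all that by (intro cfun.subspace_scale cfun.subspace_sum W) auto
    moreover have "(\<Sum>j\<in>{1..n}. \<gamma> i - \<gamma> j) = of_nat n *\<^sub>C \<gamma> i"
      unfolding sum_subtractf sum0 by (simp add: fun_eq_iff sum_fun_apply cscale_def)
    ultimately show ?thesis using n by simp
  qed
  show ?thesis
  proof safe
    fix e :: "nat \<Rightarrow> complex"
    have "gradient n e = (\<Sum>i\<in>{1..n}. e i *\<^sub>C \<gamma> i)"
    proof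
      fix x :: "nat \<times> nat" obtain i j where x: "x = (i, j)" by force
      show "gradient n e x = (\<Sum>i\<in>{1..n}. e i *\<^sub>C \<gamma> i) x"
        unfolding x sum_fun_apply \<gamma>_def cscale_def
      proof (cases "i \<in> {1..n} \<and> j \<in> {1..n}")
        case True
        have *: "e k * of_bool (l = k) = (if l = k then e k else 0)" for k l by simp
        show "gradient n e (i, j) = (\<Sum>k\<in>{1..n}. e k * gradient n (\<lambda>i. of_bool (i = k)) (i, j))"
          unfolding grad[OF True] right_diff_distrib sum_subtractf * using True by simp
      next
        case False
        show "gradient n e (i, j) = (\<Sum>k\<in>{1..n}. e k * gradient n (\<lambda>i. of_bool (i = k)) (i, j))"
          unfolding grad0[OF False] by simp
      qed
    qed
    also have "\<dots> \<in> W" by (intro cfun.subspace_sum cfun.subspace_scale W \<gamma>W)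
    finally show "gradient n e \<in> W" .
  qed
qed

lemma alt_subset:
  assumes W: "cfun.subspace W" "cyc n \<subseteq> W" "range (gradient n) \<subseteq> W"
  shows "alt n \<subseteq> W"
proof
  fix b assume b: "b \<in> alt n"
  show "b \<in> W"
  proof (cases "n = 0")
    case True
    then have "b = 0" using altD(3)[OF b] by (auto simp: fun_eq_iff)
    then show ?thesis using W by (simp add: cfun.subspace_0)
  next
    case False
    have "(1 / of_nat n) *\<^sub>C ((of_nat n *\<^sub>C b - gradient n (rowsum n b)) + gradient n (rowsum n
        b)) \<in> W"
      using W alt_decomposition[OF b] by (intro cfun.subspace_scale cfun.subspace_add) auto
    then show ?thesis using False by simp
  qed
qed

text \<open>The criterion by which a single matrix is shown to generate everything: the cyclic sum
  tests its component in \<open>cyc n\<close>, the row sum its gradient component.\<close>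

lemma alt_subset_if_generic:
  assumes W: "cfun.subspace W" "pull_invariant n W" and b: "b \<in> W" "b \<in> alt n"
    and ijk: "{i, j, k} \<subseteq> {1..n}" "b (i, j) + b (j, k) + b (k, i) \<noteq> 0" "rowsum n b i \<noteq> 0"
  shows "alt n \<subseteq> W"
proof -
  have cyc: "cyc n \<subseteq> W" using cyc_subset[OF W b ijk(1,2)] .
  have "of_nat n *\<^sub>C b - (of_nat n *\<^sub>C b - gradient n (rowsum n b)) \<in> W"
    by (rule cfun.subspace_diff[OF W(1) cfun.subspace_scale[OF W(1) b(1)]
          subsetD[OF cyc alt_decomposition[OF b(2)]]])
  then have g: "gradient n (rowsum n b) \<in> W" by simp
  \<comment> \<open>The row sums total zero, so they cannot all equal the same non-zero
    number.\<close>
  have "\<exists>q\<in>{1..n}. rowsum n b i \<noteq> rowsum n b q"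
  proof (rule ccontr)
    assume "\<not> ?thesis"
    then have "(\<Sum>q\<in>{1..n}. rowsum n b q) = (\<Sum>q\<in>{1..n}. rowsum n b i)"
      by (intro sum.cong refl) metis
    then have "of_nat n * rowsum n b i = 0" unfolding sum_rowsum[OF b(2)] by simp
    then show False using ijk(1,3) by auto
  qed
  then obtain q where q: "q \<in> {1..n}" "rowsum n b i \<noteq> rowsum n b q" by blast
  have "i \<in> {1..n}" using ijk(1) by blast
  then have "range (gradient n) \<subseteq> W" by (rule gradients_subset[OF W g _ q])
  then show ?thesis using alt_subset W cyc by blast
qed

section \<open>The group algebra of the symmetric group\<close>

lemma carrier_Sym [simp]: "carrier (Sym n) = {\<sigma>. \<sigma> permutes {1..n}}"
  and mult_Sym [simp]: "\<sigma> \<otimes>\<^bsub>Sym n\<^esub> \<tau> = \<tau> \<circ> \<sigma>"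
  and one_Sym [simp]: "\<one>\<^bsub>Sym n\<^esub> = id"
  by (simp_all add: Sym_def)

lemma group_Sym: "group (Sym n)"
proof (rule groupI)
  fix x assume "x \<in> carrier (Sym n)"
  then show "\<exists>y\<in>carrier (Sym n). y \<otimes>\<^bsub>Sym n\<^esub> x = \<one>\<^bsub>Sym n\<^esub>"
    using permutes_inv permutes_inv_o(1) by fastforce
qed (auto simp: permutes_compose permutes_id o_assoc)

lemma finite_carrier_Sym: "finite (carrier (Sym n))"
  by (simp add: finite_permutations)

lemma inv_Sym:
  assumes "g permutes {1..n}"
  shows "inv\<^bsub>Sym n\<^esub> g = Hilbert_Choice.inv g"
proof -
  interpret group "Sym n" by (rule group_Sym)
  show ?thesis
    using assms permutes_inv[OF assms] permutes_inv_o(1)[OF assms] by (intro inv_equality) simp_all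
qed

abbreviation translate :: "nat \<Rightarrow> (nat \<Rightarrow> nat) \<Rightarrow> ((nat \<Rightarrow> nat) \<Rightarrow> complex) \<Rightarrow> (nat \<Rightarrow> nat) \<Rightarrow> complex"
    where
  "translate n g \<equiv> ga_mult (Sym n) (gbasis g)"

lemma translate_eq:
  assumes "g permutes {1..n}"
  shows "translate n g f = (\<lambda>x. if x permutes {1..n} then f (x \<circ> Hilbert_Choice.inv g) else 0)"
  using group.ga_mult_gbasis[OF group_Sym finite_carrier_Sym, of g n f] assms
  unfolding inv_Sym[OF assms] carrier_Sym mult_Sym mem_Collect_eq by blast

lemma translate_add:
  "g permutes {1..n} \<Longrightarrow> translate n g (v + w) = translate n g v + translate n g w"
  using group.gbasis_mult_add[OF group_Sym finite_carrier_Sym] by simp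

lemma translate_scale:
  "g permutes {1..n} \<Longrightarrow> translate n g (c *\<^sub>C v) = c *\<^sub>C translate n g v"
  using group.gbasis_mult_scale[OF group_Sym finite_carrier_Sym] by simp

lemma translate_sum:
  "g permutes {1..n} \<Longrightarrow> translate n g (\<Sum>i\<in>A. v i) = (\<Sum>i\<in>A. translate n g (v i))"
  using group.gbasis_mult_sum[OF group_Sym finite_carrier_Sym] by simp

text \<open>One linear map for three families F, so that invariance, minimality and generation are
  proved once. The sum runs over ordered pairs; an alternating family meets every pair twice, which
  is the source of the factors 2 and 4 further on.\<close>

definition comb :: "nat \<Rightarrow> (nat \<Rightarrow> nat \<Rightarrow> (nat \<Rightarrow> nat) \<Rightarrow> complex) \<Rightarrow>
    (nat \<times> nat \<Rightarrow> complex) \<Rightarrow> (nat \<Rightarrow> nat) \<Rightarrow> complex" where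
  "comb n F b = (\<Sum>p\<in>{1..n}. \<Sum>q\<in>{1..n}. b (p, q) *\<^sub>C F p q)"

text \<open>The permuted indices stand inside \<open>translate\<close>, which keeps inverses out of
  the condition; under \<open>comb\<close>, translation then becomes \<open>pull\<close>.\<close>

definition equivariant :: "nat \<Rightarrow> (nat \<Rightarrow> nat \<Rightarrow> (nat \<Rightarrow> nat) \<Rightarrow> complex) \<Rightarrow> bool" where
  "equivariant n F \<longleftrightarrow>
    (\<forall>g p q. g permutes {1..n} \<longrightarrow> translate n g (F (g p) (g q)) = F p q)"

lemma comb_apply: "comb n F b x = (\<Sum>p\<in>{1..n}. \<Sum>q\<in>{1..n}. b (p, q) * F p q x)"
  by (simp add: comb_def sum_fun_apply cscale_def)

lemma comb_add: "comb n F (a + b) = comb n F a + comb n F b"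
  by (simp add: comb_def cfun.scale_left_distrib sum.distrib)

lemma comb_scale: "comb n F (c *\<^sub>C b) = c *\<^sub>C comb n F b"
  unfolding fun_eq_iff comb_apply by (simp add: cscale_def comb_apply sum_distrib_left mult.assoc)

lemma comb_zero: "comb n F 0 = 0"
  by (simp add: comb_def)

lemma comb_diff: "comb n F (a - b) = comb n F a - comb n F b"
  by (simp add: comb_def cfun.scale_left_diff_distrib sum_subtractf)

lemma translate_comb:
  assumes F: "equivariant n F" and g: "g permutes {1..n}"
  shows "translate n g (comb n F b) = comb n F (pull g b)"
proof -
  have *: "translate n g (F (g p) (g q)) = F p q" for p q
    by (rule F[unfolded equivariant_def, rule_format, OF g])
  have e: "comb n F b = (\<Sum>p\<in>{1..n}. \<Sum>q\<in>{1..n}. b (g p, g q) *\<^sub>C F (g p) (g q))"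
    unfolding comb_def sum.permute[OF g, of "\<lambda>p. \<Sum>q\<in>{1..n}. b (p, q) *\<^sub>C F p q"] o_apply
  proof (rule sum.cong[OF refl])
    fix p show "(\<Sum>q\<in>{1..n}. b (g p, q) *\<^sub>C F (g p) q) = (\<Sum>q\<in>{1..n}. b (g p, g q) *\<^sub>C F (g p) (g q))"
      unfolding sum.permute[OF g, of "\<lambda>q. b (g p, q) *\<^sub>C F (g p) q"] o_apply ..
  qed
  have "translate n g (comb n F b) = (\<Sum>p\<in>{1..n}. \<Sum>q\<in>{1..n}. b (g p, g q) *\<^sub>C translate n g (F (g
      p) (g q)))"
    unfolding e translate_sum[OF g] translate_scale[OF g] ..
  also have "\<dots> = (\<Sum>p\<in>{1..n}. \<Sum>q\<in>{1..n}. b (g p, g q) *\<^sub>C F p q)"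
    by (simp only: *)
  also have "\<dots> = comb n F (pull g b)"
    by (simp only: comb_def pull_def prod.case)
  finally show ?thesis .
qed

lemma subspace_comb_image: "cfun.subspace V \<Longrightarrow> cfun.subspace (comb n F ` V)"
  using image_eqI[where b = 0 and f = "comb n F" and x = 0 and A = V]
  by (auto simp: cfun.subspace_def comb_zero comb_add[symmetric] comb_scale[symmetric])

lemma left_invariant_comb_image:
  assumes "equivariant n F" "pull_invariant n V"
  shows "left_invariant (Sym n) (comb n F ` V)"
  using assms by (auto simp: left_invariant_def pull_invariant_def translate_comb)

lemma subspace_comb_vimage: "cfun.subspace V \<Longrightarrow> cfun.subspace W \<Longrightarrow> cfun.subspace {b \<in> V. comb n F b
    \<in> W}"
  by (auto simp: cfun.subspace_def comb_add comb_scale comb_zero)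

lemma pull_invariant_comb_vimage:
  assumes "equivariant n F" "pull_invariant n V" "left_invariant (Sym n) W"
  shows "pull_invariant n {b \<in> V. comb n F b \<in> W}"
  using assms by (auto simp: left_invariant_def pull_invariant_def translate_comb[symmetric])

lemma comb_elt:
  assumes "p \<in> {1..n}" "q \<in> {1..n}"
  shows "comb n F (elt p q) = F p q - F q p"
proof -
  have "comb n F (elt p q) = (\<Sum>i\<in>{1..n}. \<Sum>j\<in>{1..n}. if j = q then if i = p then F p q else 0 else 0)
      - (\<Sum>i\<in>{1..n}. \<Sum>j\<in>{1..n}. if j = p then if i = q then F q p else 0 else 0)"
    unfolding comb_def sum_subtractf[symmetric]
    by (intro sum.cong) (auto simp: elt_def cfun.scale_left_diff_distrib)
  then show ?thesis using assms by simp
qed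

section \<open>Minimal invariant spaces and their images in the group algebra\<close>

definition pull_minimal :: "nat \<Rightarrow> (nat \<times> nat \<Rightarrow> complex) set \<Rightarrow> bool" where
  "pull_minimal n V \<longleftrightarrow> cfun.subspace V \<and> pull_invariant n V \<and>
     (\<forall>W. cfun.subspace W \<longrightarrow> pull_invariant n W \<longrightarrow> W \<subseteq> V \<longrightarrow> W \<noteq> {0} \<longrightarrow> W = V)"

lemma subspace_neq_0: "cfun.subspace W \<Longrightarrow> W \<noteq> {0} \<Longrightarrow> \<exists>w\<in>W. w \<noteq> 0"
  using cfun.subspace_0 by blast

text \<open>The matrices in V that \<open>comb n F\<close> sends into W form a non-zero
  \<open>pull\<close>-invariant subspace of V, hence all of V.\<close>

lemma comb_image_minimal:
  assumes F: "equivariant n F" and V: "pull_minimal n V"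
    and W: "cfun.subspace W" "left_invariant (Sym n) W" "W \<subseteq> comb n F ` V" "W \<noteq> {0}"
  shows "W = comb n F ` V"
proof -
  let ?P = "{b \<in> V. comb n F b \<in> W}"
  obtain w where w: "w \<in> W" "w \<noteq> 0" using subspace_neq_0[OF W(1,4)] by blast
  then obtain b where "b \<in> V" "w = comb n F b" using W(3) by blast
  then have "b \<in> ?P" "b \<noteq> 0" using w by (auto simp: comb_zero)
  then have "?P \<noteq> {0}" by blast
  then have "?P = V"
    using V subspace_comb_vimage[OF _ W(1), of V n F] pull_invariant_comb_vimage[OF F _ W(2), of V]
    unfolding pull_minimal_def by blast
  then show ?thesis using W(3) by blast
qed

lemma irreducible_comb_image:
  assumes F: "equivariant n F" and V: "pull_minimal n V"
    and ne: "comb n F ` V \<noteq> {0}" and ga: "comb n F ` V \<subseteq> group_algebra (Sym n)"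
  shows "irreducible_rep (Sym n) (rep_restrict (left_regular (Sym n)) (comb n F ` V))"
proof -
  have "group_rep (Sym n) (rep_restrict (left_regular (Sym n)) (comb n F ` V))"
    using V by (intro group.group_rep_restrict group_Sym finite_carrier_Sym subspace_comb_image
        left_invariant_comb_image F ga) (auto simp: pull_minimal_def)
  moreover have "W = {0} \<or> W = comb n F ` V"
    if "cfun.subspace W" "W \<subseteq> comb n F ` V" "\<forall>g\<in>carrier (Sym n). \<forall>w\<in>W. translate n g w \<in> W" for W
    using comb_image_minimal[OF F V that(1) _ that(2)] that(3) unfolding left_invariant_def by blast
  ultimately show ?thesis
    using ne unfolding irreducible_rep_def by (simp add: rep_restrict_def left_regular_def)
qed

text \<open>The left ideal generated by a non-zero vector of the image is a non-zero invariant
  subspace of the image, so minimality applies.\<close>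

lemma principal_left_ideal_eq_comb_image:
  assumes F: "equivariant n F" and V: "pull_minimal n V"
    and ga: "comb n F ` V \<subseteq> group_algebra (Sym n)"
    and b: "b \<in> V" "comb n F b \<noteq> 0"
  shows "principal_left_ideal (Sym n) (comb n F b) = comb n F ` V"
proof (rule comb_image_minimal[OF F V])
  interpret group "Sym n" by (rule group_Sym)
  note fin = finite_carrier_Sym
  show "cfun.subspace (principal_left_ideal (Sym n) (comb n F b))"
    by (rule subspace_principal_left_ideal[OF fin])
  show "left_invariant (Sym n) (principal_left_ideal (Sym n) (comb n F b))"
    by (rule left_invariant_principal_left_ideal[OF fin])
  show "principal_left_ideal (Sym n) (comb n F b) \<subseteq> comb n F ` V"
    using V b(1) by (intro principal_left_ideal_least[OF fin] subspace_comb_image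
        left_invariant_comb_image F) (auto simp: pull_minimal_def)
  have "comb n F b \<in> principal_left_ideal (Sym n) (comb n F b)"
    using ga b(1) by (intro generator_in_principal_left_ideal[OF fin]) blast
  then show "principal_left_ideal (Sym n) (comb n F b) \<noteq> {0}" using b(2) by blast
qed

text \<open>Summed over k, the cyclic sums b(i,j) + b(j,k) + b(k,i) give n b(i,j), because row and
  column sums vanish; a non-zero entry thus forces a non-zero cyclic sum. For n \<le> 2 the space is
  {0}, which \<open>pull_minimal\<close> admits.\<close>

lemma pull_minimal_cyc: "pull_minimal n (cyc n)"
  unfolding pull_minimal_def
proof (intro conjI allI impI subspace_cyc pull_invariant_cyc)
  fix W assume W: "cfun.subspace W" "pull_invariant n W" "W \<subseteq> cyc n" "W \<noteq> {0}"
  then obtain b where b: "b \<in> W" "b \<noteq> 0" using subspace_neq_0 by blast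
  have bc: "b \<in> cyc n" and alt: "b \<in> alt n" using b(1) W(3) by (auto simp: cyc_def)
  obtain i j where ij: "b (i, j) \<noteq> 0" using b(2) by (auto simp: fun_eq_iff)
  then have i: "i \<in> {1..n}" and j: "j \<in> {1..n}" using altD(3,4)[OF alt] by blast+
  have r: "(\<Sum>k\<in>{1..n}. b (l, k)) = 0" for l using bc by (simp add: cyc_def rowsum_def)
  have c: "(\<Sum>k\<in>{1..n}. b (k, i)) = 0"
  proof -
    have "(\<Sum>k\<in>{1..n}. b (k, i)) = (\<Sum>k\<in>{1..n}. - b (i, k))"
      by (intro sum.cong refl altD(1)[OF alt])
    then show ?thesis using r[of i] by (simp add: sum_negf)
  qed
  have "(\<Sum>k\<in>{1..n}. b (i, j) + b (j, k) + b (k, i)) = of_nat n * b (i, j)"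
    unfolding sum.distrib r c by simp
  moreover have "of_nat n * b (i, j) \<noteq> 0" using ij i by auto
  ultimately have "(\<Sum>k\<in>{1..n}. b (i, j) + b (j, k) + b (k, i)) \<noteq> 0" by simp
  then obtain k where k: "k \<in> {1..n}" "b (i, j) + b (j, k) + b (k, i) \<noteq> 0"
    by (rule sum.not_neutral_contains_not_neutral)
  have "{i, j, k} \<subseteq> {1..n}" using i j k(1) by blast
  then have "cyc n \<subseteq> W" using cyc_subset[OF W(1,2) b(1) alt _ k(2)] by blast
  then show "W = cyc n" using W(3) by blast
qed

lemma subspace_gradient: "cfun.subspace (range (gradient n))"
proof (rule cfun.subspaceI)
  have "0 = gradient n (\<lambda>i. 0)" by (simp add: gradient_def fun_eq_iff)
  then show "0 \<in> range (gradient n)" by blast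
next
  fix a b assume "a \<in> range (gradient n)" "b \<in> range (gradient n)"
  then obtain c d where "a = gradient n c" "b = gradient n d" by blast
  then have "a + b = gradient n (\<lambda>i. c i + d i)" by (auto simp: gradient_def fun_eq_iff)
  then show "a + b \<in> range (gradient n)" by blast
next
  fix k b assume "b \<in> range (gradient n)"
  then obtain d where "b = gradient n d" by blast
  then have "k *\<^sub>C b = gradient n (\<lambda>i. k * d i)"
    by (auto simp: gradient_def fun_eq_iff cscale_def algebra_simps)
  then show "k *\<^sub>C b \<in> range (gradient n)" by blast
qed

lemma pull_minimal_gradient: "pull_minimal n (range (gradient n))"
  unfolding pull_minimal_def
proof (intro conjI allI impI subspace_gradient)
  show "pull_invariant n (range (gradient n))"
    by (auto simp: pull_invariant_def pull_gradient)
  fix W assume W: "cfun.subspace W" "pull_invariant n W" "W \<subseteq> range (gradient n)" "W \<noteq> {0}"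
  then obtain b where b: "b \<in> W" "b \<noteq> 0" using subspace_neq_0 by blast
  then obtain c where c: "b = gradient n c" using W(3) by blast
  obtain i j where "b (i, j) \<noteq> 0" using b(2) by (auto simp: fun_eq_iff)
  then have ij: "i \<in> {1..n}" "j \<in> {1..n}" "c i \<noteq> c j"
    by (auto simp: c gradient_def split: if_splits)
  have "range (gradient n) \<subseteq> W" by (rule gradients_subset[OF W(1,2) b(1)[unfolded c] ij])
  then show "W = range (gradient n)" using W(3) by blast
qed

section \<open>Equivariant families in the group algebra\<close>

text \<open>\<open>sgnv n p q\<close> is \<open>sqrt(n!) e\<^sub>p\<^sub>q\<close>, extended to an alternating family in \<open>p\<close> and \<open>q\<close>.\<close>

definition sgnv :: "nat \<Rightarrow> nat \<Rightarrow> nat \<Rightarrow> (nat \<Rightarrow> nat) \<Rightarrow> complex" where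
  "sgnv n p q = (\<lambda>x. if x permutes {1..n} then of_int (sgn (int (x q) - int (x p))) else 0)"

definition pos :: "nat \<Rightarrow> nat \<Rightarrow> (nat \<Rightarrow> nat) \<Rightarrow> complex" where
  "pos n p = (\<lambda>x. of_bool (x permutes {1..n} \<and> x p = n))"

text \<open>The difference gives the indicators \<open>pos\<close> the two-index shape that
  \<open>comb\<close> expects.\<close>

definition posdiff :: "nat \<Rightarrow> nat \<Rightarrow> nat \<Rightarrow> (nat \<Rightarrow> nat) \<Rightarrow> complex" where
  "posdiff n p q = pos n p - pos n q"

definition pos2 :: "nat \<Rightarrow> nat \<Rightarrow> nat \<Rightarrow> (nat \<Rightarrow> nat) \<Rightarrow> complex" where
  "pos2 n p q = (\<lambda>x. of_bool (x permutes {1..n} \<and> x p = n - 1 \<and> x q = n))"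

definition unit_const :: "nat \<Rightarrow> (nat \<Rightarrow> nat) \<Rightarrow> complex" where
  "unit_const n = (\<lambda>x. of_bool (x permutes {1..n}))"

lemma equivariantI:
  assumes inv: "\<And>g p q x. g permutes {1..n} \<Longrightarrow> x permutes {1..n} \<Longrightarrow> F (g p) (g q) (x \<circ>
      Hilbert_Choice.inv g) = F p q x"
    and zero: "\<And>p q x. \<not> x permutes {1..n} \<Longrightarrow> F p q x = 0"
  shows "equivariant n F"
  unfolding equivariant_def
proof (intro allI impI ext)
  fix g p q x assume g: "g permutes {1..n}"
  show "translate n g (F (g p) (g q)) x = F p q x"
    unfolding translate_eq[OF g] using inv[OF g] zero by auto
qed

lemma permutes_comp_inv:
  assumes "g permutes S"
  shows "x permutes S \<Longrightarrow> (x \<circ> Hilbert_Choice.inv g) permutes S" "(x \<circ> Hilbert_Choice.inv g) (g p) =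
      x p"
  using assms permutes_compose[OF permutes_inv[OF assms]] permutes_inverses[OF assms] by auto

lemma equivariant_sgnv: "equivariant n (sgnv n)"
  by (rule equivariantI) (simp_all only: sgnv_def permutes_comp_inv if_True if_False)

lemma equivariant_posdiff: "equivariant n (posdiff n)"
  by (rule equivariantI)
     (simp_all only: posdiff_def pos_def permutes_comp_inv fun_diff_def simp_thms of_bool_eq
         diff_self)

lemma equivariant_pos2: "equivariant n (pos2 n)"
  by (rule equivariantI) (simp_all only: pos2_def permutes_comp_inv simp_thms of_bool_eq)

lemma comb_in_group_algebra:
  assumes "\<And>p q x. \<not> x permutes {1..n} \<Longrightarrow> F p q x = 0"
  shows "comb n F b \<in> group_algebra (Sym n)"
  using assms by (simp add: group_algebra_def comb_apply)

lemma comb_sgnv_in: "comb n (sgnv n) b \<in> group_algebra (Sym n)"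
  by (rule comb_in_group_algebra) (simp add: sgnv_def)

lemma comb_posdiff_in: "comb n (posdiff n) b \<in> group_algebra (Sym n)"
  by (rule comb_in_group_algebra) (simp add: posdiff_def pos_def)

lemma comb_pos2_in: "comb n (pos2 n) b \<in> group_algebra (Sym n)"
  by (rule comb_in_group_algebra) (simp add: pos2_def)

lemma unit_const_in: "unit_const n \<in> group_algebra (Sym n)"
  by (simp add: group_algebra_def unit_const_def)

lemma translate_unit_const:
  assumes "g permutes {1..n}"
  shows "translate n g (unit_const n) = unit_const n"
  unfolding translate_eq[OF assms] unit_const_def fun_eq_iff
  using permutes_comp_inv(1)[OF assms] by auto

section \<open>Kernels of the three maps on alternating matrices\<close>

lemma comb_pos2_apply:
  assumes b: "b \<in> alt n" and x: "x permutes {1..n}" "x p = n - 1" "x q = n" and n: "n \<ge> 2"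
  shows "comb n (pos2 n) b x = b (p, q)"
proof -
  have eq: "x i = n - 1 \<longleftrightarrow> i = p" "x i = n \<longleftrightarrow> i = q" for i
    using x inj_eq[OF permutes_inj[OF x(1)], of i p] inj_eq[OF permutes_inj[OF x(1)], of i q] by
        auto
  have pq: "p \<in> {1..n}" "q \<in> {1..n}"
    using permutes_in_image[OF x(1), of p] permutes_in_image[OF x(1), of q] x n by auto
  have "comb n (pos2 n) b x = (\<Sum>i\<in>{1..n}. \<Sum>j\<in>{1..n}. if j = q then if i = p then b (p, q) else 0
      else 0)"
    unfolding comb_apply pos2_def eq using x(1) by (intro sum.cong refl) auto
  then show ?thesis using pq by simp
qed

lemma comb_pos2_inj:
  assumes b: "b \<in> alt n" and n: "n \<ge> 3" and z: "comb n (pos2 n) b = 0"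
  shows "b = 0"
proof
  fix y :: "nat \<times> nat" obtain p q where y: "y = (p, q)" by force
  show "b y = 0 y"
  proof (cases "p \<in> {1..n} \<and> q \<in> {1..n} \<and> p \<noteq> q")
    case True
    \<comment> \<open>\<open>three_transitive\<close> prescribes three values, so a third position r
      is supplied and sent to n - 2.\<close>
    have "card {p, q} < card {1..n}" using True n by (simp add: card_insert_if)
    then have "\<not> {1..n} \<subseteq> {p, q}" by (meson card_mono finite.emptyI finite.insertI leD)
    then obtain r where r: "r \<in> {1..n}" "r \<noteq> p" "r \<noteq> q" by blast
    have "{p, q, r} \<subseteq> {1..n}" "distinct [p, q, r]" "{n - 1, n, n - 2} \<subseteq> {1..n}" "distinct [n - 1,
        n, n - 2]"
      using True r n by auto
    then obtain x where "x permutes {1..n}" "x p = n - 1" "x q = n" by (rule three_transitive)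
    then have "b (p, q) = 0" using comb_pos2_apply[OF b, of x p q] n z by simp
    then show ?thesis by (simp add: y)
  next
    case False
    then have "b (p, q) = 0" using altD(2)[OF b, of p] altD(3)[OF b, of p q] altD(4)[OF b, of q p]
        by blast
    then show ?thesis by (simp add: y)
  qed
qed

text \<open>Exchanging p and q in the part with \<open>pos n q\<close> reproduces the other part by
  alternation. Hence only row sums enter, and the kernel on \<open>alt n\<close> is
  \<open>cyc n\<close>.\<close>

lemma comb_posdiff_alt:
  assumes b: "b \<in> alt n"
  shows "comb n (posdiff n) b = (\<Sum>p\<in>{1..n}. (2 * rowsum n b p) *\<^sub>C pos n p)"
proof
  fix x
  have "comb n (posdiff n) b x = (\<Sum>p\<in>{1..n}. \<Sum>q\<in>{1..n}. b (p, q) * pos n p x)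
      - (\<Sum>p\<in>{1..n}. \<Sum>q\<in>{1..n}. b (p, q) * pos n q x)"
    by (simp add: comb_apply posdiff_def right_diff_distrib sum_subtractf)
  moreover have "(\<Sum>p\<in>{1..n}. \<Sum>q\<in>{1..n}. b (p, q) * pos n q x) = - (\<Sum>p\<in>{1..n}. \<Sum>q\<in>{1..n}. b (p, q)
      * pos n p x)"
  proof -
    have "(\<Sum>p\<in>{1..n}. \<Sum>q\<in>{1..n}. b (p, q) * pos n q x) = (\<Sum>q\<in>{1..n}. \<Sum>p\<in>{1..n}. b (p, q) * pos n q
        x)"
      by (rule sum.swap)
    also have "\<dots> = (\<Sum>q\<in>{1..n}. \<Sum>p\<in>{1..n}. - (b (q, p) * pos n q x))"
      by (intro sum.cong refl) (subst altD(1)[OF b], simp)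
    also have "\<dots> = - (\<Sum>q\<in>{1..n}. \<Sum>p\<in>{1..n}. b (q, p) * pos n q x)"
      by (simp only: sum_negf)
    finally show ?thesis .
  qed
  ultimately have "comb n (posdiff n) b x = 2 * (\<Sum>p\<in>{1..n}. \<Sum>q\<in>{1..n}. b (p, q) * pos n p x)"
    by simp
  also have "\<dots> = (\<Sum>p\<in>{1..n}. (2 * rowsum n b p) *\<^sub>C pos n p) x"
    by (simp add: sum_fun_apply cscale_def rowsum_def sum_distrib_left sum_distrib_right mult.assoc)
  finally show "comb n (posdiff n) b x = (\<Sum>p\<in>{1..n}. (2 * rowsum n b p) *\<^sub>C pos n p) x" .
qed

lemma comb_posdiff_rowsum:
  assumes b: "b \<in> alt n" and z: "comb n (posdiff n) b = 0"
  shows "rowsum n b p = 0"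
proof (cases "p \<in> {1..n}")
  case True
  \<comment> \<open>A permutation with value n at position p; evaluating there reads off
    \<open>2 * rowsum n b p\<close>.\<close>
  define x where "x = transpose p n"
  have x: "x permutes {1..n}" unfolding x_def using True by (intro permutes_swap_id) auto
  have eq: "x i = n \<longleftrightarrow> i = p" for i
    using inj_eq[OF permutes_inj[OF x], of i p] by (simp add: x_def)
  have "0 = (\<Sum>i\<in>{1..n}. (2 * rowsum n b i) *\<^sub>C pos n i) x"
    using z comb_posdiff_alt[OF b] by simp
  also have "\<dots> = (\<Sum>i\<in>{1..n}. if i = p then 2 * rowsum n b p else 0)"
    unfolding sum_fun_apply cscale_def pos_def eq using x by (intro sum.cong refl) auto
  also have "\<dots> = 2 * rowsum n b p" using True by simp
  finally show ?thesis by simp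
next
  case False
  then show ?thesis unfolding rowsum_def by (intro sum.neutral ballI altD(3)[OF b])
qed

lemma comb_posdiff_cyc:
  assumes "b \<in> cyc n"
  shows "comb n (posdiff n) b = 0"
  using assms comb_posdiff_alt[of b n] by (simp add: cyc_def)

text \<open>
  The vectors \<open>e\<^sub>p\<^sub>q\<close> and the constants are linearly independent: exchanging the values 1 and 2 of
  a permutation with \<open>\<sigma>(i) = 1\<close>, \<open>\<sigma>(j) = 2\<close> changes no order relation except that of \<open>\<sigma>(i)\<close> and
      \<open>\<sigma>(j)\<close>.
\<close>

lemma comb_sgnv_const:
  assumes b: "b \<in> alt n" and n: "n \<ge> 3" and z: "comb n (sgnv n) b = c *\<^sub>C unit_const n"
  shows "b = 0"
proof
  fix y :: "nat \<times> nat" obtain i j where y: "y = (i, j)" by force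
  show "b y = 0 y"
  proof (cases "i \<in> {1..n} \<and> j \<in> {1..n} \<and> i \<noteq> j")
    case True
    have "card {i, j} < card {1..n}" using True n by (simp add: card_insert_if)
    then have "\<not> {1..n} \<subseteq> {i, j}" by (meson card_mono finite.emptyI finite.insertI leD)
    then obtain r where r: "r \<in> {1..n}" "r \<noteq> i" "r \<noteq> j" by blast
    have "{i, j, r} \<subseteq> {1..n}" "distinct [i, j, r]" "{1, 2, 3} \<subseteq> {1..n}" "distinct [1, 2, 3::nat]"
      using True r n by auto
    then obtain x where x: "x permutes {1..n}" "x i = 1" "x j = 2" by (rule three_transitive)
    define t :: "nat \<Rightarrow> nat" where "t = transpose 1 2"
    have t: "t permutes {1..n}" unfolding t_def using n by (intro permutes_swap_id) auto
    have tx: "(t \<circ> x) permutes {1..n}" by (rule permutes_compose[OF x(1) t])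
    have eq: "x l = 1 \<longleftrightarrow> l = i" "x l = 2 \<longleftrightarrow> l = j" for l
      using x inj_eq[OF permutes_inj[OF x(1)], of l i] inj_eq[OF permutes_inj[OF x(1)], of l j] by
          auto
    have diff: "sgnv n p q x - sgnv n p q (t \<circ> x) = 2 * elt i j (p, q)"
      if pq: "p \<in> {1..n}" "q \<in> {1..n}" for p q
    proof -
      have ge: "x p \<ge> 1" "x q \<ge> 1"
        using permutes_in_image[OF x(1), of p] permutes_in_image[OF x(1), of q] pq by auto
      have e: "elt i j (p, q) = of_bool (x p = 1 \<and> x q = 2) - of_bool (x p = 2 \<and> x q = 1)"
        unfolding eq elt_def prod.inject ..
      have s: "sgnv n p q x = of_int (sgn (int (x q) - int (x p)))"
        "sgnv n p q (t \<circ> x) = of_int (sgn (int (t (x q)) - int (t (x p))))"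
        using x(1) tx unfolding sgnv_def by simp_all
      consider "x p = 1" | "x p = 2" | "x p > 2" using ge by linarith
      then show ?thesis unfolding e s
        by cases (use ge in \<open>auto simp: t_def transpose_def sgn_if\<close>)
    qed
    \<comment> \<open>The constant cancels in this difference, so the same computation separates the
      family from the constants.\<close>
    have "0 = comb n (sgnv n) b x - comb n (sgnv n) b (t \<circ> x)"
      unfolding z using x(1) tx by (simp add: cscale_def unit_const_def)
    also have "\<dots> = (\<Sum>p\<in>{1..n}. \<Sum>q\<in>{1..n}. b (p, q) * (sgnv n p q x - sgnv n p q (t \<circ> x)))"
      unfolding comb_apply by (simp add: right_diff_distrib sum_subtractf)
    also have "\<dots> = (\<Sum>p\<in>{1..n}. \<Sum>q\<in>{1..n}. (if q = j then if p = i then 2 * b (i, j) else 0 else 0)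
        - (if q = i then if p = j then 2 * b (j, i) else 0 else 0))"
      by (intro sum.cong refl) (auto simp: diff elt_def)
    also have "\<dots> = 2 * b (i, j) - 2 * b (j, i)"
      unfolding sum_subtractf using True by simp
    also have "\<dots> = 4 * b (i, j)" using altD(1)[OF b, of j i] by simp
    finally show ?thesis by (simp add: y)
  next
    case False
    then have "b (i, j) = 0" using altD(2)[OF b, of i] altD(3)[OF b, of i j] altD(4)[OF b, of j i]
        by blast
    then show ?thesis by (simp add: y)
  qed
qed

section \<open>The constants and the space H\<close>

lemma const_space_eq: "const_space n = range (\<lambda>c. c *\<^sub>C unit_const n)"
proof -
  have "(\<Sum>\<sigma>\<in>carrier (Sym n). gbasis \<sigma>) = unit_const n"
    by (rule ext) (simp add: sum_fun_apply gbasis_def unit_const_def of_bool_def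
        finite_permutations)
  then show ?thesis unfolding const_space_def cfun.span_singleton by simp
qed

text \<open>On the diagonal the two sides differ: the sign in \<open>e_vec\<close> defaults to -1,
  while \<open>sgn\<close> of 0 is 0.\<close>

lemma e_vec_eq:
  assumes "i \<noteq> j"
  shows "e_vec n i j = complex_of_real (1 / sqrt (fact n)) *\<^sub>C sgnv n i j"
proof -
  have "(\<Sum>\<sigma>\<in>carrier (Sym n). (if \<sigma> i < \<sigma> j then 1 else - 1) *\<^sub>C gbasis \<sigma>) = sgnv n i j"
  proof
    fix x
    have "(\<Sum>\<sigma>\<in>carrier (Sym n). (if \<sigma> i < \<sigma> j then 1 else - 1) *\<^sub>C gbasis \<sigma>) x
        = (\<Sum>\<sigma>\<in>carrier (Sym n). if \<sigma> = x then if x i < x j then 1 else - 1 else 0)"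
      unfolding sum_fun_apply by (intro sum.cong refl) (auto simp: gbasis_def cscale_def)
    also have "\<dots> = sgnv n i j x"
    proof (cases "x permutes {1..n}")
      case True
      then have "x i \<noteq> x j" using assms inj_eq[OF permutes_inj[OF True]] by simp
      then show ?thesis using True finite_carrier_Sym[of n] by (auto simp: sgnv_def sgn_if)
    next
      case False
      then show ?thesis using finite_carrier_Sym[of n] by (simp add: sgnv_def)
    qed
    finally show "(\<Sum>\<sigma>\<in>carrier (Sym n). (if \<sigma> i < \<sigma> j then 1 else - 1) *\<^sub>C gbasis \<sigma>) x = sgnv n i j
        x" .
  qed
  then show ?thesis unfolding e_vec_def by simp
qed

lemma sgnv_swap: "sgnv n q p = - sgnv n p q"
  by (auto simp: sgnv_def fun_eq_iff sgn_if)

text \<open>Passing from the generators with i < j to all alternating matrices makes the parameters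
  stable under relabelling: a permutation may reverse the order of i and j, and alternation absorbs
  the sign.\<close>

lemma H_space_eq: "H_space n = comb n (sgnv n) ` alt n"
proof (rule antisym)
  show "H_space n \<subseteq> comb n (sgnv n) ` alt n"
    unfolding H_space_def
  proof (rule cfun.span_minimal[OF _ subspace_comb_image[OF subspace_alt]], safe)
    fix i j assume ij: "1 \<le> i" "i < j" "j \<le> n"
    have m: "i \<in> {1..n}" "j \<in> {1..n}" using ij by auto
    let ?c = "complex_of_real (1 / sqrt (fact n))"
    have "comb n (sgnv n) (elt i j) = 2 *\<^sub>C sgnv n i j"
      unfolding comb_elt[OF m] sgnv_swap[of n j i] by (simp add: fun_eq_iff cscale_def)
    \<comment> \<open>\<open>comb\<close> meets the pair in both orders; the resulting 2 is divided
      out.\<close>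
    then have "e_vec n i j = comb n (sgnv n) ((?c / 2) *\<^sub>C elt i j)"
      using ij by (simp add: comb_scale e_vec_eq)
    then show "e_vec n i j \<in> comb n (sgnv n) ` alt n"
      using cfun.subspace_scale[OF subspace_alt elt_in_alt[OF m]] by blast
  qed
  have sub: "cfun.subspace (H_space n)" unfolding H_space_def by (rule cfun.subspace_span)
  have lt: "sgnv n i j \<in> H_space n" if "1 \<le> i" "i < j" "j \<le> n" for i j
  proof -
    let ?c = "complex_of_real (1 / sqrt (fact n))"
    have "e_vec n i j \<in> H_space n"
      unfolding H_space_def using that by (intro cfun.span_base) blast
    then have "(1 / ?c) *\<^sub>C e_vec n i j \<in> H_space n" by (rule cfun.subspace_scale[OF sub])
    moreover have "?c \<noteq> 0" by simp
    ultimately show ?thesis using that by (simp add: e_vec_eq)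
  qed
  have "sgnv n i j \<in> H_space n" if ij: "i \<in> {1..n}" "j \<in> {1..n}" for i j
  proof -
    consider "i < j" | "i = j" | "j < i" by linarith
    then show ?thesis
    proof cases
      case 1
      then show ?thesis using lt ij by simp
    next
      case 2
      then have "sgnv n i j = 0" by (simp add: sgnv_def fun_eq_iff)
      then show ?thesis using cfun.subspace_0[OF sub] by simp
    next
      case 3
      then have "sgnv n j i \<in> H_space n" using lt ij by simp
      then show ?thesis unfolding sgnv_swap[of n i j] by (rule cfun.subspace_neg[OF sub])
    qed
  qed
  then show "comb n (sgnv n) ` alt n \<subseteq> H_space n"
    unfolding comb_def by (auto intro!: cfun.subspace_sum[OF sub] cfun.subspace_scale[OF sub])
qed

section \<open>The three Specht modules\<close>

lemma sum_gbasis: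
  assumes "finite A"
  shows "(\<Sum>p\<in>A. f p *\<^sub>C gbasis p) = (\<lambda>x. if x \<in> A then f x else 0)"
  using assms
  by (auto simp: fun_eq_iff sum_fun_apply cscale_def gbasis_def if_distrib[of "\<lambda>y. f _ * y"] cong:
      if_cong)

text \<open>Writing x as \<open>p \<otimes> r\<close>, that is \<open>r \<circ> p\<close>, with p in
  the column group forces r to be \<open>x \<circ> inv p\<close>, which must lie in the row
  group.\<close>

lemma young_symmetrizer_apply:
  assumes x: "x permutes {1..n}"
  shows "young_symmetrizer n \<mu> x =
    (\<Sum>p\<in>column_group n \<mu>. of_int (sign p) * of_bool (x \<circ> Hilbert_Choice.inv p \<in> row_group n \<mu>))"
proof -
  have sub: "column_group n \<mu> \<subseteq> carrier (Sym n)" and "row_group n \<mu> \<subseteq> carrier (Sym n)"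
    by (auto simp: column_group_def row_group_def)
  then have fin: "finite (column_group n \<mu>)" "finite (row_group n \<mu>)"
    using finite_carrier_Sym finite_subset by blast+
  have r: "row_symmetrizer n \<mu> = (\<lambda>x. if x \<in> row_group n \<mu> then 1 else 0)"
    using sum_gbasis[OF fin(2), of "\<lambda>_. 1"] by (simp add: row_symmetrizer_def)
  have "young_symmetrizer n \<mu> x = (\<Sum>g\<in>carrier (Sym n). column_antisymmetrizer n \<mu> g *
      translate n g (row_symmetrizer n \<mu>) x)"
    unfolding young_symmetrizer_def ga_mult_eq_sum[OF finite_carrier_Sym, of n
        "column_antisymmetrizer n \<mu>"]
    by (simp add: sum_fun_apply cscale_def)
  also have "\<dots> = (\<Sum>g\<in>column_group n \<mu>. column_antisymmetrizer n \<mu> g *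
      translate n g (row_symmetrizer n \<mu>) x)"
    by (rule sum.mono_neutral_right[OF finite_carrier_Sym sub])
       (simp add: column_antisymmetrizer_def sum_gbasis[OF fin(1)])
  also have "\<dots> = (\<Sum>p\<in>column_group n \<mu>. of_int (sign p) * of_bool (x \<circ> Hilbert_Choice.inv p \<in>
      row_group n \<mu>))"
  proof (rule sum.cong[OF refl])
    fix p assume p: "p \<in> column_group n \<mu>"
    then have "p permutes {1..n}" using sub by auto
    from translate_eq[OF this] p x show "column_antisymmetrizer n \<mu> p * translate n p
        (row_symmetrizer n \<mu>) x =
        of_int (sign p) * of_bool (x \<circ> Hilbert_Choice.inv p \<in> row_group n \<mu>)"
      by (simp add: column_antisymmetrizer_def sum_gbasis[OF fin(1)] r)
  qed
  finally show ?thesis .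
qed

lemma young_symmetrizer_outside:
  assumes "\<not> x permutes {1..n}"
  shows "young_symmetrizer n \<mu> x = 0"
  using ga_mult_in[OF group_Sym, of n "column_antisymmetrizer n \<mu>" "row_symmetrizer n \<mu>"] assms
  by (simp add: young_symmetrizer_def group_algebra_def)

text \<open>Made for hooks filled along the rows: an entry of the first row lies in the column of
  its own number, and T is the first column. As 1 is in T, no other entry has column number 1, so
  all further columns are singletons.\<close>

lemma column_group_eq:
  assumes T: "T \<subseteq> {1..n}"
    and c: "\<And>k. k \<in> {1..n} \<Longrightarrow> snd (cell \<mu> k) = (if k \<in> T then 1 else k)" and "1 \<in> T"
  shows "column_group n \<mu> = {p. p permutes T}"
proof (intro equalityI subsetI)
  fix p assume "p \<in> column_group n \<mu>"
  then have p: "p permutes {1..n}" and col: "\<And>k. k \<in> {1..n} \<Longrightarrow> snd (cell \<mu> (p k)) = snd (cell \<mu> k)"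
    by (auto simp: column_group_def)
  have "p k = k" if "k \<in> {1..n} - T" for k
  proof -
    have "p k \<in> {1..n}" using permutes_in_image[OF p, of k] that by blast
    then have "(if p k \<in> T then 1 else p k) = k" using col[of k] c[of k] c[of "p k"] that by simp
    then show ?thesis using \<open>1 \<in> T\<close> that by (auto split: if_splits)
  qed
  then show "p \<in> {p. p permutes T}" using permutes_superset[OF p] by simp
next
  fix p assume "p \<in> {p. p permutes T}"
  then have pT: "p permutes T" by simp
  then have p: "p permutes {1..n}" using T permutes_subset by blast
  have "snd (cell \<mu> (p k)) = snd (cell \<mu> k)" if k: "k \<in> {1..n}" for k
  proof -
    have "p k \<in> {1..n}" using k permutes_in_image[OF p, of k] by blast
    then show ?thesis
      using c[OF k] c[of "p k"] permutes_in_image[OF pT, of k] permutes_not_in[OF pT, of k] by simp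
  qed
  then show "p \<in> column_group n \<mu>" using p by (simp add: column_group_def)
qed

lemma young_symmetrizer_trivial:
  assumes n: "n \<ge> 3"
  shows "young_symmetrizer n [n] = unit_const n"
proof
  fix x
  show "young_symmetrizer n [n] x = unit_const n x"
  proof (cases "x permutes {1..n}")
    case True
    have C: "column_group n [n] = {id}"
      using column_group_eq[of "{1}" n "[n]"] n by simp
    have "fst (cell [n] (x k)) = fst (cell [n] k)" if "k \<in> {1..n}" for k
      using that permutes_in_image[OF True, of k] by simp
    then have "x \<in> row_group n [n]" using True by (simp add: row_group_def)
    then show ?thesis using True by (simp add: young_symmetrizer_apply C unit_const_def)
  qed (simp add: young_symmetrizer_outside unit_const_def)
qed

text \<open>The second row contains only n, so preserving rows amounts to fixing n; injectivity
  keeps the other entries in the first row.\<close>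

lemma row_group_hook2:
  assumes n: "n \<ge> 3"
  shows "row_group n [n - 1, 1] = {p. p permutes {1..n} \<and> p n = n}"
proof -
  have r: "fst (cell [n - 1, 1] k) = of_bool (k = n)" if "k \<in> {1..n}" for k
    using that n by auto
  have "(\<forall>k\<in>{1..n}. fst (cell [n - 1, 1] (p k)) = fst (cell [n - 1, 1] k)) \<longleftrightarrow> p n = n"
    if p: "p permutes {1..n}" for p
  proof -
    have "(\<forall>k\<in>{1..n}. fst (cell [n - 1, 1] (p k)) = fst (cell [n - 1, 1] k))
        \<longleftrightarrow> (\<forall>k\<in>{1..n}. (p k = n) = (k = n))"
    proof (intro ball_cong refl)
      fix k assume k: "k \<in> {1..n}"
      then have "p k \<in> {1..n}" using permutes_in_image[OF p, of k] by blast
      then show "(fst (cell [n - 1, 1] (p k)) = fst (cell [n - 1, 1] k)) = ((p k = n) = (k = n))"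
        unfolding r[OF k] r[OF \<open>p k \<in> {1..n}\<close>] by simp
    qed
    also have "\<dots> \<longleftrightarrow> p n = n"
    proof
      assume "p n = n"
      then show "\<forall>k\<in>{1..n}. (p k = n) = (k = n)"
        using inj_eq[OF permutes_inj[OF p], of _ n] by simp
    qed (use n in simp)
    finally show ?thesis .
  qed
  then show ?thesis unfolding row_group_def by blast
qed

lemma row_group_hook3:
  assumes n: "n \<ge> 3"
  shows "row_group n [n - 2, 1, 1] = {p. p permutes {1..n} \<and> p (n - 1) = n - 1 \<and> p n = n}"
proof -
  define c where "c k = (if k = n then 2 else if k = n - 1 then 1 else 0 :: nat)" for k
  have r: "fst (cell [n - 2, 1, 1] k) = c k" if "k \<in> {1..n}" for k
    using that n by (auto simp: c_def)
  have "(\<forall>k\<in>{1..n}. fst (cell [n - 2, 1, 1] (p k)) = fst (cell [n - 2, 1, 1] k)) \<longleftrightarrow>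
      p (n - 1) = n - 1 \<and> p n = n" if p: "p permutes {1..n}" for p
  proof -
    have "(\<forall>k\<in>{1..n}. fst (cell [n - 2, 1, 1] (p k)) = fst (cell [n - 2, 1, 1] k))
        \<longleftrightarrow> (\<forall>k\<in>{1..n}. c (p k) = c k)"
    proof (intro ball_cong refl)
      fix k assume k: "k \<in> {1..n}"
      then have "p k \<in> {1..n}" using permutes_in_image[OF p, of k] by blast
      then show "(fst (cell [n - 2, 1, 1] (p k)) = fst (cell [n - 2, 1, 1] k)) = (c (p k) = c k)"
        unfolding r[OF k] r[OF \<open>p k \<in> {1..n}\<close>] by simp
    qed
    also have "\<dots> \<longleftrightarrow> p (n - 1) = n - 1 \<and> p n = n"
    proof
      assume "\<forall>k\<in>{1..n}. c (p k) = c k"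
      then have "c (p n) = 2" "c (p (n - 1)) = 1" using n by (auto simp: c_def)
      moreover have "c l = 2 \<longleftrightarrow> l = n" "c l = 1 \<longleftrightarrow> l = n - 1" for l using n by (auto simp: c_def)
      ultimately show "p (n - 1) = n - 1 \<and> p n = n" by blast
    next
      assume a: "p (n - 1) = n - 1 \<and> p n = n"
      have "p k = n \<longleftrightarrow> k = n" "p k = n - 1 \<longleftrightarrow> k = n - 1" for k
        using a inj_eq[OF permutes_inj[OF p], of k n] inj_eq[OF permutes_inj[OF p], of k "n - 1"]
            by auto
      then show "\<forall>k\<in>{1..n}. c (p k) = c k" by (simp add: c_def)
    qed
    finally show ?thesis .
  qed
  then show ?thesis unfolding row_group_def by blast
qed

text \<open>The column group consists of the identity, which asks for x n = n, and the transposition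
  of 1 and n, which asks for x 1 = n with sign -1.\<close>

lemma young_symmetrizer_hook2:
  assumes n: "n \<ge> 3"
  shows "young_symmetrizer n [n - 1, 1] = posdiff n n 1"
proof
  fix x
  show "young_symmetrizer n [n - 1, 1] x = posdiff n n 1 x"
  proof (cases "x permutes {1..n}")
    case True
    have "column_group n [n - 1, 1] = {p. p permutes {1, n}}"
      using n by (intro column_group_eq) auto
    also have "\<dots> = {id, transpose 1 n}" by (auto simp: permutes_doubleton_iff)
    finally have C: "column_group n [n - 1, 1] = {id, transpose 1 n}" .
    have ne: "id \<noteq> transpose 1 n"
    proof
      assume "id = transpose 1 n"
      then have "id 1 = transpose 1 n 1" by metis
      then show False using n by simp
    qed
    have "transpose 1 n permutes {1..n}" using n by (intro permutes_swap_id) auto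
    then have xt: "(x \<circ> transpose 1 n) permutes {1..n}" using True permutes_compose by blast
    show ?thesis
      unfolding young_symmetrizer_apply[OF True] C row_group_hook2[OF n]
      using ne n True xt by (simp add: sign_swap_id posdiff_def pos_def)
  qed (simp add: young_symmetrizer_outside posdiff_def pos_def)
qed

text \<open>After p is replaced by its inverse, each of the six permutations p of {1, n - 1, n}
  contributes its sign times the indicator \<open>pos2\<close> at (p (n - 1), p n). These six signed
  pairs are the entries of the 3-cycle.\<close>

lemma young_symmetrizer_hook3:
  assumes n: "n \<ge> 3"
  shows "young_symmetrizer n [n - 2, 1, 1] = comb n (pos2 n) (cycle3 (n - 1) n 1)"
proof
  fix x
  show "young_symmetrizer n [n - 2, 1, 1] x = comb n (pos2 n) (cycle3 (n - 1) n 1) x"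
  proof (cases "x permutes {1..n}")
    case True
    define m where "m = n - 1"
    have m: "m \<noteq> n" "m \<noteq> 1" "n \<noteq> 1" "1 \<noteq> m" "1 \<noteq> n" "n \<noteq> m" using n by (auto simp: m_def)
    define f where "f p = of_int (sign p) * pos2 n (p m) (p n) x" for p
    have C: "column_group n [n - 2, 1, 1] = {p. p permutes {1, m, n}}"
      unfolding m_def using n by (intro column_group_eq) auto
    have "young_symmetrizer n [n - 2, 1, 1] x = (\<Sum>p\<in>{p. p permutes {1, m, n}}. f
        (Hilbert_Choice.inv p))"
      unfolding young_symmetrizer_apply[OF True] C
    proof (rule sum.cong[OF refl])
      fix p assume "p \<in> {p. p permutes {1, m, n}}"
      then have p: "p permutes {1, m, n}" by simp
      then have p': "p permutes {1..n}" by (rule permutes_subset) (use n in \<open>auto simp: m_def\<close>)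
      have "(x \<circ> Hilbert_Choice.inv p) permutes {1..n}"
        by (rule permutes_compose[OF permutes_inv[OF p'] True])
      then have "of_bool (x \<circ> Hilbert_Choice.inv p \<in> row_group n [n - 2, 1, 1]) =
          pos2 n (Hilbert_Choice.inv p m) (Hilbert_Choice.inv p n) x"
        unfolding row_group_hook3[OF n] pos2_def m_def using True by simp
      moreover have "sign (Hilbert_Choice.inv p) = sign p"
        using p by (intro sign_inverse permutes_imp_permutation[of "{1, m, n}"]) auto
      ultimately show "of_int (sign p) * of_bool (x \<circ> Hilbert_Choice.inv p \<in> row_group n [n - 2,
          1, 1]) =
          f (Hilbert_Choice.inv p)"
        by (simp add: f_def)
    qed
    also have "\<dots> = (\<Sum>p\<in>{p. p permutes {1, m, n}}. f p)"
      by (rule sum_permutations_inverse[symmetric])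
    \<comment> \<open>A permutation of {1, m, n} is uniquely a permutation q of {m, n} followed by
      \<open>transpose 1 b\<close>; each b yields one of the three \<open>elt\<close> terms.\<close>
    also have "\<dots> = (\<Sum>b\<in>{1, m, n}. \<Sum>q\<in>{q. q permutes {m, n}}. f (transpose 1 b \<circ> q))"
      using m by (intro sum_over_permutations_insert) auto
    also have "{q. q permutes {m, n}} = {id, transpose m n}"
      by (auto simp: permutes_doubleton_iff)
    also have "(\<Sum>b\<in>{1, m, n}. \<Sum>q\<in>{id, transpose m n}. f (transpose 1 b \<circ> q)) =
       (\<Sum>b\<in>{1, m, n}. f (transpose 1 b) + f (transpose 1 b \<circ> transpose m n))"
    proof -
      have "id \<noteq> transpose m n" using m(1) by (metis id_apply transpose_apply_first)
      then show ?thesis by simp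
    qed
    also have "\<dots> = pos2 n m n x - pos2 n n m x + (pos2 n n 1 x - pos2 n 1 n x)
        + (pos2 n 1 m x - pos2 n m 1 x)"
      using m by (simp add: f_def sign_compose permutation_swap_id sign_swap_id transpose_def)
    also have "\<dots> = comb n (pos2 n) (cycle3 m n 1) x"
      using n unfolding cycle3_def comb_add by (simp add: comb_elt m_def)
    finally show ?thesis by (simp add: m_def)
  next
    case False
    then show ?thesis
      using comb_pos2_in[of n "cycle3 (n - 1) n 1"] by (simp add: young_symmetrizer_outside
          group_algebra_def)
  qed
qed

section \<open>The ideals generated by the Young symmetrizers\<close>

lemma specht_trivial:
  assumes n: "n \<ge> 3"
  shows "principal_left_ideal (Sym n) (young_symmetrizer n [n]) = range (\<lambda>c. c *\<^sub>C unit_const n)"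
proof
  interpret group "Sym n" by (rule group_Sym)
  note fin = finite_carrier_Sym
  have sub: "cfun.subspace (range (\<lambda>c. c *\<^sub>C unit_const n))"
    using cfun.subspace_span[of "{unit_const n}"] by (simp add: cfun.span_singleton)
  have inv: "left_invariant (Sym n) (range (\<lambda>c. c *\<^sub>C unit_const n))"
    by (auto simp: left_invariant_def translate_scale translate_unit_const)
  show "principal_left_ideal (Sym n) (young_symmetrizer n [n]) \<subseteq> range (\<lambda>c. c *\<^sub>C unit_const n)"
    unfolding young_symmetrizer_trivial[OF n]
    by (rule principal_left_ideal_least[OF fin sub inv]) (rule range_eqI[of _ _ 1], simp)
  show "range (\<lambda>c. c *\<^sub>C unit_const n) \<subseteq> principal_left_ideal (Sym n) (young_symmetrizer n [n])"
    unfolding young_symmetrizer_trivial[OF n]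
    using cfun.subspace_scale[OF subspace_principal_left_ideal[OF fin]]
      generator_in_principal_left_ideal[OF fin unit_const_in] by blast
qed

lemma unit_const_neq_0: "unit_const n \<noteq> 0"
proof -
  have "unit_const n id = 1" by (simp add: unit_const_def permutes_id)
  then show ?thesis by auto
qed

lemma irreducible_specht_trivial:
  assumes n: "n \<ge> 3"
  shows "irreducible_rep (Sym n) (specht_rep n [n])"
proof -
  interpret group "Sym n" by (rule group_Sym)
  let ?U = "principal_left_ideal (Sym n) (young_symmetrizer n [n])"
  note fin = finite_carrier_Sym
  have "group_rep (Sym n) (specht_rep n [n])"
    unfolding specht_rep_def
    by (intro group_rep_restrict fin subspace_principal_left_ideal
        left_invariant_principal_left_ideal
        principal_left_ideal_subset)
  moreover have "unit_const n \<in> ?U"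
    unfolding young_symmetrizer_trivial[OF n]
    by (rule generator_in_principal_left_ideal[OF fin unit_const_in])
  then have "?U \<noteq> {0}" using unit_const_neq_0[of n] by blast
  moreover have "W = {0} \<or> W = ?U" if W: "cfun.subspace W" "W \<subseteq> ?U" for W
  proof (rule ccontr)
    assume a: "\<not> (W = {0} \<or> W = ?U)"
    then obtain w where w: "w \<in> W" "w \<noteq> 0" using subspace_neq_0[OF W(1)] by blast
    then obtain c where c: "w = c *\<^sub>C unit_const n" using W(2) unfolding specht_trivial[OF n] by
        blast
    then have "c \<noteq> 0" using w by auto
    have "d *\<^sub>C unit_const n \<in> W" for d
      using cfun.subspace_scale[OF W(1) w(1), of "d / c"] \<open>c \<noteq> 0\<close> by (simp add: c)
    then show False using W(2) a unfolding specht_trivial[OF n] by blast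
  qed
  ultimately show ?thesis
    unfolding irreducible_rep_def by (simp add: specht_rep_def rep_restrict_def left_regular_def)
qed

text \<open>The function sums to zero, so its gradient has row sums n times it, and
  \<open>comb n (posdiff n)\<close> doubles row sums. Dividing by 2 n leaves the coefficients 1 at n
  and -1 at 1.\<close>

lemma posdiff_eq_comb:
  assumes n: "n \<ge> 3"
  shows "posdiff n n 1 = comb n (posdiff n) (gradient n (\<lambda>i. (of_bool (i = n) - of_bool (i = 1)) /
      (2 * of_nat n)))"
    (is "_ = comb n (posdiff n) (gradient n ?c)")
proof -
  have s: "(\<Sum>i\<in>{1..n}. ?c i) = 0"
    using n unfolding sum_divide_distrib[symmetric] sum_subtractf by simp
  have "comb n (posdiff n) (gradient n ?c) = (\<Sum>p\<in>{1..n}. (2 * (of_nat n * ?c p)) *\<^sub>C pos n p)"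
    unfolding comb_posdiff_alt[OF gradient_in_alt]
    by (intro sum.cong refl) (simp only: rowsum_gradient s diff_0_right)
  also have "\<dots> = (\<Sum>p\<in>{1..n}. (if p = n then pos n n else 0) - (if p = 1 then pos n 1 else 0))"
    using n by (intro sum.cong refl) auto
  also have "\<dots> = posdiff n n 1"
    using n unfolding sum_subtractf posdiff_def by simp
  finally show ?thesis ..
qed

lemma specht_hook2:
  assumes n: "n \<ge> 3"
  shows "principal_left_ideal (Sym n) (young_symmetrizer n [n - 1, 1]) = comb n (posdiff n) `
      range (gradient n)"
proof -
  have "transpose 1 n permutes {1..n}" using n by (intro permutes_swap_id) auto
  then have "posdiff n n 1 (transpose 1 n) \<noteq> 0" using n by (simp add: posdiff_def pos_def)
  then have "posdiff n n 1 \<noteq> 0" by auto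
  then show ?thesis
    unfolding young_symmetrizer_hook2[OF n] posdiff_eq_comb[OF n]
    by (intro principal_left_ideal_eq_comb_image equivariant_posdiff pull_minimal_gradient)
       (auto simp: comb_posdiff_in)
qed

lemma specht_hook3:
  assumes n: "n \<ge> 3"
  shows "principal_left_ideal (Sym n) (young_symmetrizer n [n - 2, 1, 1]) = comb n (pos2 n) ` cyc n"
    and "comb n (pos2 n) (cycle3 (n - 1) n 1) \<noteq> 0"
proof -
  have z: "cycle3 (n - 1) n 1 \<in> cyc n" using n by (intro cycle3_in_cyc) auto
  have "n - 1 \<noteq> n" "n - 1 \<noteq> 1" "n \<noteq> 1" using n by arith+
  then have "cycle3 (n - 1) n 1 (n - 1, n) = 1" by (simp add: cycle3_def elt_def)
  then have "cycle3 (n - 1) n 1 \<noteq> 0" by auto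
  then show nz: "comb n (pos2 n) (cycle3 (n - 1) n 1) \<noteq> 0"
    using comb_pos2_inj[OF _ n] z by (auto simp: cyc_def)
  show "principal_left_ideal (Sym n) (young_symmetrizer n [n - 2, 1, 1]) = comb n (pos2 n) ` cyc n"
    unfolding young_symmetrizer_hook3[OF n]
    using z nz by (intro principal_left_ideal_eq_comb_image equivariant_pos2 pull_minimal_cyc)
       (auto simp: comb_pos2_in)
qed

lemma irreducible_specht_hook2:
  assumes n: "n \<ge> 3"
  shows "irreducible_rep (Sym n) (specht_rep n [n - 1, 1])"
  unfolding specht_rep_def specht_hook2[OF n]
proof (rule irreducible_comb_image[OF equivariant_posdiff pull_minimal_gradient])
  have "transpose 1 n permutes {1..n}" using n by (intro permutes_swap_id) auto
  then have "posdiff n n 1 (transpose 1 n) \<noteq> 0" using n by (simp add: posdiff_def pos_def)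
  then have "posdiff n n 1 \<noteq> 0" by auto
  then show "comb n (posdiff n) ` range (gradient n) \<noteq> {0}" unfolding posdiff_eq_comb[OF n] by blast
qed (auto simp: comb_posdiff_in)

lemma irreducible_specht_hook3:
  assumes n: "n \<ge> 3"
  shows "irreducible_rep (Sym n) (specht_rep n [n - 2, 1, 1])"
  unfolding specht_rep_def specht_hook3(1)[OF n]
proof (rule irreducible_comb_image[OF equivariant_pos2 pull_minimal_cyc])
  have "cycle3 (n - 1) n 1 \<in> cyc n" using n by (intro cycle3_in_cyc) auto
  then show "comb n (pos2 n) ` cyc n \<noteq> {0}" using specht_hook3(2)[OF n] by blast
qed (auto simp: comb_pos2_in)

section \<open>The ideal generated by a weighted inversion statistic\<close>

definition weighted_inv :: "nat \<Rightarrow> (nat \<Rightarrow> nat \<Rightarrow> nat) \<Rightarrow> (nat \<Rightarrow> nat) \<Rightarrow> nat" where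
  "weighted_inv n w \<sigma> = (\<Sum>i\<in>{1..n}. \<Sum>j\<in>{1..n}. if i < j \<and> \<sigma> j < \<sigma> i then w i j else 0)"

lemma weighted_inv_one: "weighted_inv n (\<lambda>i j. 1) = inversions n"
proof
  fix \<sigma> :: "nat \<Rightarrow> nat"
  have s: "{(i, j). 1 \<le> i \<and> i < j \<and> j \<le> n \<and> \<sigma> i > \<sigma> j} = {p \<in> {1..n} \<times> {1..n}. fst p < snd p \<and> \<sigma>
      (snd p) < \<sigma> (fst p)}"
    by auto
  have "inversions n \<sigma> = (\<Sum>p\<in>{1..n} \<times> {1..n}. if fst p < snd p \<and> \<sigma> (snd p) < \<sigma> (fst p) then 1 else
      0)"
    unfolding inversions_def s card_eq_sum by (rule sum.inter_filter) simp
  then show "weighted_inv n (\<lambda>i j. 1) \<sigma> = inversions n \<sigma>"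
    unfolding weighted_inv_def by (simp add: sum.cartesian_product split_def)
qed

lemma weighted_inv_adjacent:
  "weighted_inv n (\<lambda>i j. if j = i + 1 then v i else 0) \<sigma> = (\<Sum>i\<in>Des n \<sigma>. v i)"
proof -
  have "weighted_inv n (\<lambda>i j. if j = i + 1 then v i else 0) \<sigma>
      = (\<Sum>i\<in>{1..n}. if i \<in> Des n \<sigma> then v i else 0)"
    unfolding weighted_inv_def
  proof (rule sum.cong[OF refl])
    fix i assume i: "i \<in> {1..n}"
    have "(\<Sum>j\<in>{1..n}. if i < j \<and> \<sigma> j < \<sigma> i then if j = i + 1 then v i else 0 else 0)
        = (\<Sum>j\<in>{1..n}. if j = i + 1 then if \<sigma> (i + 1) < \<sigma> i then v i else 0 else 0)"
      by (intro sum.cong refl) auto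
    \<comment> \<open>For i = n the index n + 1 is out of range, in agreement with
      \<open>Des\<close> stopping at n - 1.\<close>
    also have "\<dots> = (if i \<in> Des n \<sigma> then v i else 0)"
      using i by (auto simp: Des_def)
    finally show "(\<Sum>j\<in>{1..n}. if i < j \<and> \<sigma> j < \<sigma> i then if j = i + 1 then v i else 0 else 0)
        = (if i \<in> Des n \<sigma> then v i else 0)" .
  qed
  also have "\<dots> = (\<Sum>i\<in>Des n \<sigma>. v i)"
  proof (rule sum.mono_neutral_cong_right)
    show "Des n \<sigma> \<subseteq> {1..n}" by (auto simp: Des_def)
  qed auto
  finally show ?thesis .
qed

lemma weighted_inv_des: "weighted_inv n (\<lambda>i j. if j = i + 1 then 1 else 0) = des n"
  by (rule ext) (simp add: weighted_inv_adjacent[of n "\<lambda>_. 1", simplified] des_def)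

lemma weighted_inv_maj: "weighted_inv n (\<lambda>i j. if j = i + 1 then i else 0) = maj n"
  by (rule ext) (simp add: weighted_inv_adjacent[of n "\<lambda>i. i", simplified] maj_def)

section \<open>The statistics as elements of the ideal, and as its generators\<close>

definition stat_ideal :: "nat \<Rightarrow> ((nat \<Rightarrow> nat) \<Rightarrow> complex) set" where
  "stat_ideal n = {a + b |a b. a \<in> comb n (sgnv n) ` alt n \<and> b \<in> range (\<lambda>c. c *\<^sub>C unit_const n)}"

text \<open>For p < q the inversion indicator is (1 - \<open>sgnv n p q\<close>) / 2. Its sign part
  has weight -w/2, shared between the entries (p, q) and (q, p), both of which \<open>comb\<close>
  counts: hence 1/4 and the signs.\<close>

definition weight_matrix :: "nat \<Rightarrow> (nat \<Rightarrow> nat \<Rightarrow> nat) \<Rightarrow> nat \<times> nat \<Rightarrow> complex" where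
  "weight_matrix n w = (\<lambda>(p, q). if p \<in> {1..n} \<and> q \<in> {1..n} then
     (if q < p then of_nat (w q p) / 4 else 0) - (if p < q then of_nat (w p q) / 4 else 0) else 0)"

lemma weight_matrix_in_alt: "weight_matrix n w \<in> alt n"
  by (rule altI) (auto simp: weight_matrix_def)

lemma stat_vec_apply: "stat_vec n \<epsilon> = (\<lambda>x. if x permutes {1..n} then of_nat (\<epsilon> x) else 0)"
  unfolding stat_vec_def sum_gbasis[OF finite_carrier_Sym] by simp

lemma stat_vec_decomposition:
  "stat_vec n (weighted_inv n w) = comb n (sgnv n) (weight_matrix n w) +
     (\<Sum>p\<in>{1..n}. \<Sum>q\<in>{1..n}. if p < q then of_nat (w p q) / 2 else 0) *\<^sub>C unit_const n"
proof
  fix x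
  let ?f = "\<lambda>p q. if p < q then complex_of_nat (w p q) / 4 else 0"
  show "stat_vec n (weighted_inv n w) x = (comb n (sgnv n) (weight_matrix n w) +
     (\<Sum>p\<in>{1..n}. \<Sum>q\<in>{1..n}. if p < q then of_nat (w p q) / 2 else 0) *\<^sub>C unit_const n) x"
  proof (cases "x permutes {1..n}")
    case True
    have "comb n (sgnv n) (weight_matrix n w) x = (\<Sum>p\<in>{1..n}. \<Sum>q\<in>{1..n}. (?f q p - ?f p q) * sgnv
        n p q x)"
      unfolding comb_apply by (intro sum.cong refl) (simp add: weight_matrix_def)
    also have "\<dots> = (\<Sum>p\<in>{1..n}. \<Sum>q\<in>{1..n}. ?f q p * sgnv n p q x) - (\<Sum>p\<in>{1..n}. \<Sum>q\<in>{1..n}. ?f p q *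
        sgnv n p q x)"
      by (simp only: left_diff_distrib sum_subtractf)
    also have "(\<Sum>p\<in>{1..n}. \<Sum>q\<in>{1..n}. ?f q p * sgnv n p q x) = (\<Sum>q\<in>{1..n}. \<Sum>p\<in>{1..n}. ?f q p *
        sgnv n p q x)"
      by (rule sum.swap)
    also have "\<dots> = (\<Sum>p\<in>{1..n}. \<Sum>q\<in>{1..n}. - (?f p q * sgnv n p q x))"
      by (intro sum.cong refl) (subst sgnv_swap, simp)
    finally have "comb n (sgnv n) (weight_matrix n w) x
        = (\<Sum>p\<in>{1..n}. \<Sum>q\<in>{1..n}. - (?f p q * sgnv n p q x) - ?f p q * sgnv n p q x)"
      by (simp only: sum_subtractf)
    then have "(comb n (sgnv n) (weight_matrix n w) +
     (\<Sum>p\<in>{1..n}. \<Sum>q\<in>{1..n}. if p < q then of_nat (w p q) / 2 else 0) *\<^sub>C unit_const n) x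
      = (\<Sum>p\<in>{1..n}. \<Sum>q\<in>{1..n}. (- (?f p q * sgnv n p q x) - ?f p q * sgnv n p q x)
          + (if p < q then of_nat (w p q) / 2 else 0))"
      using True by (simp only: plus_fun_apply cscale_def unit_const_def of_bool_eq mult_1_right
          sum.distrib)
    also have "\<dots> = (\<Sum>p\<in>{1..n}. \<Sum>q\<in>{1..n}. of_nat (if p < q \<and> x q < x p then w p q else 0))"
    proof (intro sum.cong refl)
      fix p q
      have "p < q \<Longrightarrow> x p \<noteq> x q" using inj_eq[OF permutes_inj[OF True], of p q] by simp
      then show "(- (?f p q * sgnv n p q x) - ?f p q * sgnv n p q x) + (if p < q then of_nat (w p
          q) / 2 else 0)
          = of_nat (if p < q \<and> x q < x p then w p q else 0)"
        using True by (auto simp: sgnv_def sgn_if)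
    qed
    also have "\<dots> = stat_vec n (weighted_inv n w) x"
      using True by (simp add: stat_vec_apply weighted_inv_def)
    finally show ?thesis ..
  next
    case False
    then show ?thesis
      using comb_sgnv_in[of n "weight_matrix n w"]
      by (simp add: stat_vec_apply cscale_def unit_const_def group_algebra_def)
  qed
qed

lemma stat_idealI: "b \<in> alt n \<Longrightarrow> comb n (sgnv n) b + c *\<^sub>C unit_const n \<in> stat_ideal n"
  unfolding stat_ideal_def by blast

lemma stat_idealE:
  assumes "v \<in> stat_ideal n"
  obtains b c where "b \<in> alt n" "v = comb n (sgnv n) b + c *\<^sub>C unit_const n"
  using assms unfolding stat_ideal_def by blast

lemma subspace_stat_ideal: "cfun.subspace (stat_ideal n)"
proof (rule cfun.subspaceI)
  show "0 \<in> stat_ideal n"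
    using stat_idealI[OF cfun.subspace_0[OF subspace_alt], of n 0] by (simp add: comb_zero)
next
  fix v v' assume "v \<in> stat_ideal n" "v' \<in> stat_ideal n"
  then obtain b c b' c' where "b \<in> alt n" "v = comb n (sgnv n) b + c *\<^sub>C unit_const n"
    "b' \<in> alt n" "v' = comb n (sgnv n) b' + c' *\<^sub>C unit_const n" by (metis stat_idealE)
  then show "v + v' \<in> stat_ideal n"
    using stat_idealI[OF cfun.subspace_add[OF subspace_alt], of b n b' "c + c'"]
    by (simp add: comb_add cfun.scale_left_distrib ac_simps)
next
  fix d v assume "v \<in> stat_ideal n"
  then obtain b c where "b \<in> alt n" "v = comb n (sgnv n) b + c *\<^sub>C unit_const n" by (metis
      stat_idealE)
  then show "d *\<^sub>C v \<in> stat_ideal n"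
    using stat_idealI[OF cfun.subspace_scale[OF subspace_alt], of b n d "d * c"]
    by (simp add: comb_scale cfun.scale_right_distrib)
qed

lemma translate_stat_ideal:
  assumes "g permutes {1..n}"
  shows "translate n g (comb n (sgnv n) b + c *\<^sub>C unit_const n) = comb n (sgnv n) (pull g b) + c
      *\<^sub>C unit_const n"
  unfolding translate_add[OF assms] translate_scale[OF assms] translate_unit_const[OF assms]
    translate_comb[OF equivariant_sgnv assms] ..

lemma pull_in_alt: "g permutes {1..n} \<Longrightarrow> b \<in> alt n \<Longrightarrow> pull g b \<in> alt n"
  using pull_invariant_alt[of n] by (simp only: pull_invariant_def)

lemma left_invariant_stat_ideal: "left_invariant (Sym n) (stat_ideal n)"
  unfolding left_invariant_def
proof safe
  fix g v assume "g \<in> carrier (Sym n)" "v \<in> stat_ideal n"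
  moreover then obtain b c where "b \<in> alt n" "v = comb n (sgnv n) b + c *\<^sub>C unit_const n" by
      (metis stat_idealE)
  ultimately show "translate n g v \<in> stat_ideal n"
    using stat_idealI[OF pull_in_alt, of g n b c] translate_stat_ideal by simp
qed

lemma stat_ideal_subset: "stat_ideal n \<subseteq> group_algebra (Sym n)"
proof
  fix v assume "v \<in> stat_ideal n"
  then obtain b c where v: "v = comb n (sgnv n) b + c *\<^sub>C unit_const n" by (metis stat_idealE)
  show "v \<in> group_algebra (Sym n)" unfolding v
    by (intro cfun.subspace_add cfun.subspace_scale subspace_group_algebra comb_sgnv_in
        unit_const_in)
qed

text \<open>For fixed x, \<open>x \<circ> inv g\<close> runs once through the whole group as g does,
  so the sum has the same value at every x.\<close>

lemma sum_translates:
  assumes u: "u \<in> group_algebra (Sym n)"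
  shows "(\<Sum>g\<in>carrier (Sym n). translate n g u) = (\<Sum>g\<in>carrier (Sym n). u g) *\<^sub>C unit_const n"
proof
  fix x
  show "(\<Sum>g\<in>carrier (Sym n). translate n g u) x = ((\<Sum>g\<in>carrier (Sym n). u g) *\<^sub>C unit_const n) x"
  proof (cases "x permutes {1..n}")
    case True
    have "(\<Sum>g\<in>carrier (Sym n). translate n g u) x = (\<Sum>g\<in>{g. g permutes {1..n}}. u (x \<circ>
        Hilbert_Choice.inv g))"
      unfolding sum_fun_apply carrier_Sym
      by (intro sum.cong refl) (simp only: mem_Collect_eq translate_eq True if_True)
    also have "\<dots> = (\<Sum>g\<in>{g. g permutes {1..n}}. u (x \<circ> g))"
      using sum_permutations_inverse[of "\<lambda>g. u (x \<circ> g)"] by simp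
    also have "\<dots> = (\<Sum>g\<in>{g. g permutes {1..n}}. u g)"
      by (rule setum_permutations_compose_left[OF True, symmetric])
    finally show ?thesis using True by (simp add: cscale_def unit_const_def)
  next
    case False
    then show ?thesis by (auto simp: sum_fun_apply translate_eq cscale_def unit_const_def intro!:
        sum.neutral)
  qed
qed

lemma sum_nat_neq_0: "finite A \<Longrightarrow> a \<in> A \<Longrightarrow> f a \<noteq> (0::nat) \<Longrightarrow> (\<Sum>x\<in>A. f x) \<noteq> 0"
  by auto

text \<open>Positivity of \<open>w 1 2\<close> is used for the total of the statistic over the group
  and for the row sum at 1; both are, up to a non-zero factor, sums of natural numbers, so nothing
  cancels. The inequality is the cyclic sum at 1, 2, 3.\<close>

lemma principal_left_ideal_weighted_inv:
  assumes n: "n \<ge> 3" and w: "w 1 2 > 0" "w 1 2 + w 2 3 \<noteq> w 1 3"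
  shows "principal_left_ideal (Sym n) (stat_vec n (weighted_inv n w)) = stat_ideal n"
proof
  interpret group "Sym n" by (rule group_Sym)
  note fin = finite_carrier_Sym
  define u where "u = stat_vec n (weighted_inv n w)"
  define b where "b = weight_matrix n w"
  define J where "J = principal_left_ideal (Sym n) u"
  obtain c where u: "u = comb n (sgnv n) b + c *\<^sub>C unit_const n"
    using stat_vec_decomposition unfolding u_def b_def by blast
  have b: "b \<in> alt n" unfolding b_def by (rule weight_matrix_in_alt)
  have uI: "u \<in> stat_ideal n" unfolding u by (rule stat_idealI[OF b])
  show "principal_left_ideal (Sym n) (stat_vec n (weighted_inv n w)) \<subseteq> stat_ideal n"
    using principal_left_ideal_least[OF fin subspace_stat_ideal left_invariant_stat_ideal uI]
    by (simp only: u_def)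
  have ug: "u \<in> group_algebra (Sym n)" using uI stat_ideal_subset by blast
  have J: "cfun.subspace J" "left_invariant (Sym n) J" "u \<in> J"
    unfolding J_def by (rule subspace_principal_left_ideal[OF fin]
      left_invariant_principal_left_ideal[OF fin] generator_in_principal_left_ideal[OF fin ug])+
  define s where "s = (\<Sum>g\<in>carrier (Sym n). u g)"
  have "s = of_nat (\<Sum>g\<in>carrier (Sym n). weighted_inv n w g)"
    unfolding s_def u_def stat_vec_apply of_nat_sum by (intro sum.cong refl) simp
  moreover have "(\<Sum>g\<in>carrier (Sym n). weighted_inv n w g) \<noteq> 0"
  proof -
    \<comment> \<open>This permutation has the inversion (1, 2), which makes one term of the total
      positive.\<close>
    have t: "transpose 1 2 \<in> carrier (Sym n)" using n by (auto intro!: permutes_swap_id)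
    have "1 \<in> {1..n}" "2 \<in> {1..n}" using n by auto
    moreover have "(if (1::nat) < 2 \<and> transpose 1 2 2 < transpose 1 2 (1::nat) then w 1 2 else 0)
        \<noteq> 0"
      using w(1) by simp
    ultimately have "weighted_inv n w (transpose 1 2) \<noteq> 0"
      unfolding weighted_inv_def
      by (intro sum_nat_neq_0[where a = 1] sum_nat_neq_0[where a = 2]) simp_all
    then show ?thesis by (rule sum_nat_neq_0[OF fin t])
  qed
  ultimately have s0: "s \<noteq> 0" by (metis of_nat_eq_0_iff)
  have "s *\<^sub>C unit_const n \<in> J"
    unfolding s_def sum_translates[OF ug, symmetric]
    using J(2,3) by (intro cfun.subspace_sum[OF J(1)]) (auto simp: left_invariant_def)
  then have "(1 / s) *\<^sub>C s *\<^sub>C unit_const n \<in> J" by (rule cfun.subspace_scale[OF J(1)])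
  then have one: "unit_const n \<in> J" using s0 by simp
  define W where "W = {a \<in> alt n. comb n (sgnv n) a \<in> J}"
  have W: "cfun.subspace W" "pull_invariant n W"
    unfolding W_def by (rule subspace_comb_vimage[OF subspace_alt J(1)]
      pull_invariant_comb_vimage[OF equivariant_sgnv pull_invariant_alt J(2)])+
  have "u - c *\<^sub>C unit_const n \<in> J"
    by (intro cfun.subspace_diff cfun.subspace_scale J one)
  then have bW: "b \<in> W" using b by (simp add: W_def u)
  have "alt n \<subseteq> W"
  proof (rule alt_subset_if_generic[OF W bW b])
    show "{1, 2, 3} \<subseteq> {1..n}" using n by auto
    have "b (1, 2) + b (2, 3) + b (3, 1) = (of_nat (w 1 3) - of_nat (w 1 2 + w 2 3)) / 4"
      using n by (simp add: b_def weight_matrix_def field_simps)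
    moreover have "complex_of_nat (w 1 3) \<noteq> of_nat (w 1 2 + w 2 3)" using w(2) by (metis
        of_nat_eq_iff)
    ultimately show "b (1, 2) + b (2, 3) + b (3, 1) \<noteq> 0"
      by (simp only: divide_eq_0_iff right_minus_eq) simp
    have "rowsum n b 1 = - of_nat (\<Sum>j\<in>{1..n}. if 1 < j then w 1 j else 0) / 4"
    proof -
      have "rowsum n b 1 = (\<Sum>j\<in>{1..n}. - (of_nat (if 1 < j then w 1 j else 0) / 4))"
        unfolding rowsum_def by (intro sum.cong refl) (auto simp: b_def weight_matrix_def)
      then show ?thesis unfolding sum_negf sum_divide_distrib[symmetric] of_nat_sum by simp
    qed
    moreover have "(\<Sum>j\<in>{1..n}. if 1 < j then w 1 j else 0) \<noteq> 0"
    proof -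
      have "2 \<in> {1..n}" "(if (1::nat) < 2 then w 1 2 else 0) \<noteq> 0" using n w(1) by auto
      then show ?thesis by (rule sum_nat_neq_0[OF finite_atLeastAtMost])
    qed
    ultimately show "rowsum n b 1 \<noteq> 0" by (simp only: neg_equal_0_iff_equal divide_eq_0_iff
        of_nat_eq_0_iff) simp
  qed
  then have "comb n (sgnv n) a + d *\<^sub>C unit_const n \<in> J" if "a \<in> alt n" for a d
    using that unfolding W_def by (intro cfun.subspace_add cfun.subspace_scale J one) blast
  then show "stat_ideal n \<subseteq> principal_left_ideal (Sym n) (stat_vec n (weighted_inv n w))"
    unfolding u_def[symmetric] J_def[symmetric] by (metis stat_idealE subsetI)
qed

lemma internal_direct_sum_stat_ideal:
  assumes n: "n \<ge> 3"
  shows "internal_direct_sum (stat_ideal n) (H_space n) (const_space n)"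
proof -
  have "v = 0" if v: "v \<in> comb n (sgnv n) ` alt n" "v \<in> range (\<lambda>c. c *\<^sub>C unit_const n)" for v
  proof -
    obtain b c where b: "b \<in> alt n" "v = comb n (sgnv n) b" "v = c *\<^sub>C unit_const n" using v by
        blast
    then have "b = 0" using comb_sgnv_const[OF b(1) n, of c] by simp
    then show ?thesis using b by (simp add: comb_zero)
  qed
  moreover have "0 \<in> comb n (sgnv n) ` alt n" "0 \<in> range (\<lambda>c. c *\<^sub>C unit_const n)"
    using cfun.subspace_0[OF subspace_comb_image[OF subspace_alt]] rangeI[of "\<lambda>c. c *\<^sub>C unit_const
        n" 0]
    by simp_all
  ultimately show ?thesis
    unfolding internal_direct_sum_def H_space_eq const_space_eq stat_ideal_def by blast
qed

section \<open>Decomposition of the ideal\<close>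

text \<open>On \<open>alt n\<close>, n times the projection onto \<open>cyc n\<close> along the
  gradients.\<close>

abbreviation cyc_part :: "nat \<Rightarrow> (nat \<times> nat \<Rightarrow> complex) \<Rightarrow> nat \<times> nat \<Rightarrow> complex" where
  "cyc_part n b \<equiv> of_nat n *\<^sub>C b - gradient n (rowsum n b)"

definition ideal_param :: "nat \<Rightarrow> complex \<times> (nat \<times> nat \<Rightarrow> complex) \<Rightarrow> (nat \<Rightarrow> nat) \<Rightarrow> complex" where
  "ideal_param n = (\<lambda>(c, b). comb n (sgnv n) b + c *\<^sub>C unit_const n)"

text \<open>\<open>comb n (posdiff n)\<close> annihilates \<open>cyc n\<close> by itself, whereas
  for n \<ge> 3 \<open>comb n (pos2 n)\<close> is injective on all alternating matrices, so there b
  is first sent to \<open>cyc n\<close>.\<close>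

definition sum_param :: "nat \<Rightarrow> complex \<times> (nat \<times> nat \<Rightarrow> complex) \<Rightarrow>
    ((nat \<Rightarrow> nat) \<Rightarrow> complex) \<times> ((nat \<Rightarrow> nat) \<Rightarrow> complex) \<times> ((nat \<Rightarrow> nat) \<Rightarrow> complex)" where
  "sum_param n = (\<lambda>(c, b). (c *\<^sub>C unit_const n, comb n (posdiff n) b, comb n (pos2 n) (cyc_part n
      b)))"

lemma cyc_part_add: "cyc_part n (a + b) = cyc_part n a + cyc_part n b"
  by (auto simp: fun_eq_iff cscale_def gradient_def rowsum_add algebra_simps)

lemma cyc_part_diff: "cyc_part n (a - b) = cyc_part n a - cyc_part n b"
  by (auto simp: fun_eq_iff cscale_def gradient_def rowsum_diff algebra_simps)

lemma cyc_part_scale: "cyc_part n (c *\<^sub>C b) = c *\<^sub>C cyc_part n b"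
  by (auto simp: fun_eq_iff cscale_def gradient_def rowsum_scale[unfolded cscale_def] algebra_simps)

lemma cyc_part_pull:
  assumes "g permutes {1..n}"
  shows "cyc_part n (pull g b) = pull g (cyc_part n b)"
proof -
  have "gradient n (rowsum n (pull g b)) = pull g (gradient n (rowsum n b))"
    unfolding pull_gradient[OF assms]
    by (rule arg_cong[of _ _ "gradient n"]) (simp add: fun_eq_iff rowsum_pull[OF assms])
  then show ?thesis by (auto simp: pull_def fun_eq_iff cscale_def)
qed

text \<open>The row sums of a gradient are n c up to a constant, which the gradient forgets. It
  follows that \<open>cyc_part n\<close> vanishes on gradients.\<close>

lemma gradient_rowsum_gradient: "gradient n (rowsum n (gradient n c)) = of_nat n *\<^sub>C gradient n c"
proof
  fix x :: "nat \<times> nat" obtain i j where x: "x = (i, j)" by force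
  show "gradient n (rowsum n (gradient n c)) x = (of_nat n *\<^sub>C gradient n c) x"
  proof (cases "i \<in> {1..n} \<and> j \<in> {1..n}")
    case True
    then have "rowsum n (gradient n c) i - rowsum n (gradient n c) j = of_nat n * (c i - c j)"
      by (simp only: rowsum_gradient right_diff_distrib) simp
    then show ?thesis using True by (simp add: x gradient_def[of n c] gradient_def[of n "rowsum n
        f" for f] cscale_def)
  next
    case False
    then show ?thesis by (auto simp: x gradient_def cscale_def)
  qed
qed

lemma bij_ideal_param:
  assumes n: "n \<ge> 3"
  shows "bij_betw (ideal_param n) (UNIV \<times> alt n) (stat_ideal n)"
proof (rule bij_betw_imageI)
  show "inj_on (ideal_param n) (UNIV \<times> alt n)"
  proof (rule inj_onI, clarify)
    fix c b c' b'
    assume b: "b \<in> alt n" "b' \<in> alt n" and eq: "ideal_param n (c, b) = ideal_param n (c', b')"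
    have "comb n (sgnv n) (b - b') = (c' - c) *\<^sub>C unit_const n"
      using eq by (simp add: ideal_param_def comb_diff cfun.scale_left_diff_distrib algebra_simps)
    then have z: "b - b' = 0"
      using comb_sgnv_const[OF cfun.subspace_diff[OF subspace_alt b] n] by blast
    then have "c *\<^sub>C unit_const n = c' *\<^sub>C unit_const n" using eq by (simp add: ideal_param_def)
    then show "c = c' \<and> b = b'" using z unit_const_neq_0[of n] by simp
  qed
  show "ideal_param n ` (UNIV \<times> alt n) = stat_ideal n"
    unfolding stat_ideal_def ideal_param_def by (auto simp: image_iff)
qed

lemma bij_sum_param:
  assumes n: "n \<ge> 3"
  shows "bij_betw (sum_param n) (UNIV \<times> alt n)
    (range (\<lambda>c. c *\<^sub>C unit_const n) \<times> comb n (posdiff n) ` range (gradient n) \<times> comb n (pos2 n) `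
        cyc n)"
proof (rule bij_betw_imageI)
  have n0: "complex_of_nat n \<noteq> 0" using n by simp
  show "inj_on (sum_param n) (UNIV \<times> alt n)"
  proof (rule inj_onI, clarify)
    fix c b c' b'
    assume b: "b \<in> alt n" "b' \<in> alt n" and eq: "sum_param n (c, b) = sum_param n (c', b')"
    define d where "d = b - b'"
    have d: "d \<in> alt n" unfolding d_def by (rule cfun.subspace_diff[OF subspace_alt b])
    have "comb n (posdiff n) d = 0" using eq by (simp add: sum_param_def d_def comb_diff)
    \<comment> \<open>With vanishing row sums \<open>cyc_part n d\<close> is n d, and the
      injectivity of \<open>comb n (pos2 n)\<close> applies to it.\<close>
    then have r: "rowsum n d = (\<lambda>_. 0)" using comb_posdiff_rowsum[OF d] by (auto simp: fun_eq_iff)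
    have "comb n (pos2 n) (cyc_part n d) = 0"
      using eq by (simp only: sum_param_def d_def cyc_part_diff comb_diff) simp
    moreover have "cyc_part n d \<in> alt n" using alt_decomposition[OF d] by (simp add: cyc_def)
    ultimately have "cyc_part n d = 0" using comb_pos2_inj n by blast
    moreover have "gradient n (rowsum n d) = 0" unfolding r by (auto simp: gradient_def fun_eq_iff)
    ultimately have "of_nat n *\<^sub>C d = 0" by simp
    then have "d = 0" using n0 by simp
    moreover have "c = c'" using eq unit_const_neq_0[of n] by (simp add: sum_param_def)
    ultimately show "c = c' \<and> b = b'" by (simp add: d_def)
  qed
  show "sum_param n ` (UNIV \<times> alt n) = range (\<lambda>c. c *\<^sub>C unit_const n) \<times> comb n (posdiff n) ` range
      (gradient n) \<times> comb n (pos2 n) ` cyc n"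
  proof (intro equalityI subsetI)
    fix y assume "y \<in> sum_param n ` (UNIV \<times> alt n)"
    then obtain c b where b: "b \<in> alt n" and y: "y = sum_param n (c, b)" by blast
    \<comment> \<open>n b differs from the gradient of its row sums by a matrix in
      \<open>cyc n\<close>, which \<open>posdiff\<close> kills.\<close>
    have "comb n (posdiff n) (gradient n (rowsum n b)) = comb n (posdiff n) (of_nat n *\<^sub>C b -
        cyc_part n b)"
      by simp
    also have "\<dots> = of_nat n *\<^sub>C comb n (posdiff n) b"
      unfolding comb_diff[of n _ _ "cyc_part n b"] comb_posdiff_cyc[OF alt_decomposition[OF b]]
          comb_scale by simp
    finally have e: "of_nat n *\<^sub>C comb n (posdiff n) b \<in> comb n (posdiff n) ` range (gradient n)"
      by (metis rangeI image_eqI)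
    have "(1 / of_nat n) *\<^sub>C of_nat n *\<^sub>C comb n (posdiff n) b \<in> comb n (posdiff n) ` range
        (gradient n)"
      by (rule cfun.subspace_scale[OF subspace_comb_image[OF subspace_gradient] e])
    then have "comb n (posdiff n) b \<in> comb n (posdiff n) ` range (gradient n)" using n0 by simp
    then show "y \<in> range (\<lambda>c. c *\<^sub>C unit_const n) \<times> comb n (posdiff n) ` range (gradient n) \<times> comb
        n (pos2 n) ` cyc n"
      using alt_decomposition[OF b] unfolding y sum_param_def prod.case by blast
  next
    fix y assume "y \<in> range (\<lambda>c. c *\<^sub>C unit_const n) \<times> comb n (posdiff n) ` range (gradient n) \<times>
        comb n (pos2 n) ` cyc n"
    then obtain c e z where z: "z \<in> cyc n"
      and y: "y = (c *\<^sub>C unit_const n, comb n (posdiff n) (gradient n e), comb n (pos2 n) z)" by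
          blast
    \<comment> \<open>\<open>cyc_part n\<close> multiplies \<open>cyc n\<close> by n, which the
      factor 1/n compensates.\<close>
    define z' where "z' = (1 / of_nat n) *\<^sub>C z"
    have z': "z' \<in> cyc n" unfolding z'_def by (rule cfun.subspace_scale[OF subspace_cyc z])
    then have r: "rowsum n z' = (\<lambda>_. 0)" by (simp add: cyc_def fun_eq_iff)
    define b where "b = gradient n e + z'"
    have b: "b \<in> alt n" unfolding b_def
      using z' by (intro cfun.subspace_add[OF subspace_alt] gradient_in_alt) (simp add: cyc_def)
    have "comb n (posdiff n) b = comb n (posdiff n) (gradient n e)"
      by (simp add: b_def comb_add comb_posdiff_cyc[OF z'])
    moreover have "cyc_part n b = z"
    proof -
      have "cyc_part n z' = of_nat n *\<^sub>C z'" unfolding r by (auto simp: gradient_def fun_eq_iff)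
      then have "cyc_part n z' = z" using n0 by (simp add: z'_def)
      then show ?thesis unfolding b_def cyc_part_add gradient_rowsum_gradient by simp
    qed
    ultimately have "y = sum_param n (c, b)" by (simp add: y sum_param_def)
    then show "y \<in> sum_param n ` (UNIV \<times> alt n)" using b by blast
  qed
qed

text \<open>In both parametrisations a permutation g acts by (c, b) to (c, \<open>pull g b\<close>),
  so one witness serves both.\<close>

lemma rep_iso_stat_ideal:
  assumes n: "n \<ge> 3"
  shows "rep_iso (Sym n) (rep_restrict (left_regular (Sym n)) (stat_ideal n))
      (rep_sum (specht_rep n [n]) (rep_sum (specht_rep n [n - 1, 1]) (specht_rep n [n - 2, 1, 1])))"
    (is "rep_iso _ ?R ?S")
proof (rule rep_iso_parametrisation[where M = "UNIV \<times> alt n" and P = "ideal_param n" and Q =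
    "sum_param n"])
  show "group_rep (Sym n) ?R"
    by (intro group.group_rep_restrict group_Sym finite_carrier_Sym subspace_stat_ideal
        left_invariant_stat_ideal stat_ideal_subset)
  show "group_rep (Sym n) ?S"
    using irreducible_specht_trivial[OF n] irreducible_specht_hook2[OF n]
        irreducible_specht_hook3[OF n]
    by (intro group_rep_rep_sum) (auto simp: irreducible_rep_def)
  show "bij_betw (ideal_param n) (UNIV \<times> alt n) (rspace ?R)"
    using bij_ideal_param[OF n] by (simp add: rep_restrict_def left_regular_def)
  have "rspace ?S = range (\<lambda>c. c *\<^sub>C unit_const n) \<times> comb n (posdiff n) ` range (gradient n) \<times>
      comb n (pos2 n) ` cyc n"
    unfolding rep_sum_def specht_rep_def specht_trivial[OF n] specht_hook2[OF n]
        specht_hook3(1)[OF n]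
    by (simp add: rep_restrict_def left_regular_def)
  then show "bij_betw (sum_param n) (UNIV \<times> alt n) (rspace ?S)"
    using bij_sum_param[OF n] by simp
  have scale: "rscale ?R = cscale" "rscale ?S = (\<lambda>c (u, v, w). (c *\<^sub>C u, c *\<^sub>C v, c *\<^sub>C w))"
    by (auto simp: rep_sum_def specht_rep_def rep_restrict_def left_regular_def fun_eq_iff)
  have act: "ract ?R = translate n" "ract ?S = (\<lambda>g (u, v, w). (translate n g u, translate n g v,
      translate n g w))"
    by (auto simp: rep_sum_def specht_rep_def rep_restrict_def left_regular_def fun_eq_iff)
  {
    fix m m' :: "complex \<times> (nat \<times> nat \<Rightarrow> complex)" assume m: "m \<in> UNIV \<times> alt n" "m' \<in> UNIV \<times> alt n"
    obtain c b c' b' where cb: "m = (c, b)" "m' = (c', b')" by force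
    have "(c + c', b + b') \<in> UNIV \<times> alt n"
      using m cfun.subspace_add[OF subspace_alt] by (simp add: cb)
    moreover have "ideal_param n (c + c', b + b') = ideal_param n m + ideal_param n m'"
      by (simp add: cb ideal_param_def comb_add cfun.scale_left_distrib ac_simps)
    moreover have "sum_param n (c + c', b + b') = sum_param n m + sum_param n m'"
      unfolding cb sum_param_def prod.case cyc_part_add by (simp add: comb_add
          cfun.scale_left_distrib)
    ultimately show "\<exists>m''\<in>UNIV \<times> alt n. ideal_param n m'' = ideal_param n m + ideal_param n m' \<and>
        sum_param n m'' = sum_param n m + sum_param n m'" by blast
  next
    fix k and m :: "complex \<times> (nat \<times> nat \<Rightarrow> complex)" assume m: "m \<in> UNIV \<times> alt n"
    obtain c b where cb: "m = (c, b)" by force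
    have "(k * c, k *\<^sub>C b) \<in> UNIV \<times> alt n"
      using m cfun.subspace_scale[OF subspace_alt] by (simp add: cb)
    moreover have "ideal_param n (k * c, k *\<^sub>C b) = rscale ?R k (ideal_param n m)"
      unfolding scale by (simp add: cb ideal_param_def comb_scale cfun.scale_right_distrib)
    moreover have "sum_param n (k * c, k *\<^sub>C b) = rscale ?S k (sum_param n m)"
      unfolding cb sum_param_def prod.case cyc_part_scale scale by (simp add: comb_scale)
    ultimately show "\<exists>m''\<in>UNIV \<times> alt n. ideal_param n m'' = rscale ?R k (ideal_param n m) \<and>
        sum_param n m'' = rscale ?S k (sum_param n m)" by blast
  next
    fix g and m :: "complex \<times> (nat \<times> nat \<Rightarrow> complex)"
    assume "g \<in> carrier (Sym n)" and m: "m \<in> UNIV \<times> alt n"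
    then have g: "g permutes {1..n}" by simp
    obtain c b where cb: "m = (c, b)" by force
    have "(c, pull g b) \<in> UNIV \<times> alt n"
      using m pull_in_alt[OF g] by (simp add: cb)
    moreover have "ideal_param n (c, pull g b) = ract ?R g (ideal_param n m)"
      unfolding act cb ideal_param_def prod.case translate_stat_ideal[OF g] ..
    moreover have "sum_param n (c, pull g b) = ract ?S g (sum_param n m)"
      unfolding act cb sum_param_def prod.case cyc_part_pull[OF g] translate_scale[OF g]
        translate_unit_const[OF g] translate_comb[OF equivariant_posdiff g] translate_comb[OF
            equivariant_pos2 g] ..
    ultimately show "\<exists>m''\<in>UNIV \<times> alt n. ideal_param n m'' = ract ?R g (ideal_param n m) \<and>
        sum_param n m'' = ract ?S g (sum_param n m)" by blast
  }
qed

theorem corollary1: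
  fixes n :: nat
  assumes "n \<ge> 3"
  shows "\<exists>I :: ((nat \<Rightarrow> nat) \<Rightarrow> complex) set.
    (\<forall>\<epsilon> \<in> {des n, maj n, inversions n}. principal_left_ideal (Sym n) (stat_vec n \<epsilon>) = I) \<and>
    internal_direct_sum I (H_space n) (const_space n) \<and>
    irreducible_rep (Sym n) (specht_rep n [n]) \<and>
    irreducible_rep (Sym n) (specht_rep n [n - 1, 1]) \<and>
    irreducible_rep (Sym n) (specht_rep n [n - 2, 1, 1]) \<and>
    rep_iso (Sym n) (rep_restrict (left_regular (Sym n)) I)
      (rep_sum (specht_rep n [n]) (rep_sum (specht_rep n [n - 1, 1]) (specht_rep n [n - 2, 1, 1])))"
proof (intro exI[of _ "stat_ideal n"] conjI ballI)
  fix \<epsilon> assume "\<epsilon> \<in> {des n, maj n, inversions n}"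
  \<comment> \<open>The condition \<open>w 1 2 + w 2 3 \<noteq> w 1 3\<close> reads 1 + 1 \<noteq> 0
    for \<open>des\<close>, 1 + 2 \<noteq> 0 for \<open>maj\<close> and 1 + 1 \<noteq> 1 for
    \<open>inversions\<close>.\<close>
  then consider "\<epsilon> = des n" | "\<epsilon> = maj n" | "\<epsilon> = inversions n" by blast
  then show "principal_left_ideal (Sym n) (stat_vec n \<epsilon>) = stat_ideal n"
  proof cases
    case 1
    then show ?thesis
      using principal_left_ideal_weighted_inv[OF assms, of "\<lambda>i j. if j = i + 1 then 1 else 0"]
      unfolding weighted_inv_des by simp
  next
    case 2
    then show ?thesis
      using principal_left_ideal_weighted_inv[OF assms, of "\<lambda>i j. if j = i + 1 then i else 0"]
      unfolding weighted_inv_maj by simp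
  next
    case 3
    then show ?thesis
      using principal_left_ideal_weighted_inv[OF assms, of "\<lambda>i j. 1"]
      unfolding weighted_inv_one by simp
  qed
qed (intro internal_direct_sum_stat_ideal irreducible_specht_trivial irreducible_specht_hook2
      irreducible_specht_hook3 rep_iso_stat_ideal assms)+

end
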